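(* Let $n\ge2$, let $\rho$ be an irreducible unitary representation of the $n$-symmetric group $\mathbb G^{[n]}$, and let $H(0)$ be the space of $K$-fixed vectors of $\rho$. Then $$\dim H(0)\le 1.$$
   Context: $S_\infty$ is the group of all permutations of $\mathbb N=\{1,2,\dots\}$; $S_\infty(\alpha)$ is the pointwise stabilizer of $1,\dots,\alpha$; $S_\infty^{fin}$ is the subgroup of finitely supported permutations. $\mathbb G^{[n]}$ is the group of $n$-tuples $(g_1,\dots,g_n)\in S_\infty^n$ such that $g_ig_j^{-1}\in S_\infty^{fin}$ for all $i,j$. $K\subset\mathbb G^{[n]}$ is the diagonal subgroup $\{(g,\dots,g):g\in S_\infty\}$, and $K(\alpha)\subset K$ is the diagonal copy of $S_\infty(\alpha)$. $\mathbb G^{[n]}$ carries the group topology in which the subgroups $K(\alpha)$ are open and form a base of neighborhoods of the identity. Unitary representations are in Hilbert spaces and are assumed continuous in this topology. *)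

theory Defs
  imports "HOL-Analysis.Analysis" "HOL-Algebra.Product_Groups" "HOL-Algebra.Coset"
    "HOL-Combinatorics.Permutations"
begin

section \<open>The \<open>n\<close>-symmetric group\<close>

definition S_inf :: "(nat \<Rightarrow> nat) monoid"
  where "S_inf = \<lparr>carrier = {p. p permutes {1..}}, mult = (\<circ>), one = id\<rparr>"

definition S_inf_stab :: "nat \<Rightarrow> (nat \<Rightarrow> nat) set"
  where "S_inf_stab \<alpha> = {p \<in> carrier S_inf. \<forall>i\<in>{1..\<alpha>}. p i = i}"

definition S_inf_fin :: "(nat \<Rightarrow> nat) set"
  where "S_inf_fin = {p \<in> carrier S_inf. finite {i. p i \<noteq> i}}"

text \<open>Tuples indexed by \<open>{1..n}\<close> are extensional functions, as in \<^const>\<open>product_group\<close>.\<close>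

definition nsym :: "nat \<Rightarrow> (nat \<Rightarrow> nat \<Rightarrow> nat) monoid"
  where "nsym n = (product_group {1..n} (\<lambda>_. S_inf))
    \<lparr>carrier := {g \<in> carrier (product_group {1..n} (\<lambda>_. S_inf)).
       \<forall>i\<in>{1..n}. \<forall>j\<in>{1..n}. g i \<otimes>\<^bsub>S_inf\<^esub> inv\<^bsub>S_inf\<^esub> (g j) \<in> S_inf_fin}\<rparr>"

text \<open>\<open>diag_stab n \<alpha>\<close> is the subgroup $K(\alpha)$; in particular \<open>diag_stab n 0\<close>
  is the full diagonal $K$, see \<open>diag_stab_0\<close> below.\<close>

definition diag_stab :: "nat \<Rightarrow> nat \<Rightarrow> (nat \<Rightarrow> nat \<Rightarrow> nat) set"
  where "diag_stab n \<alpha> = (\<lambda>p. \<lambda>i\<in>{1..n}. p) ` S_inf_stab \<alpha>"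

text \<open>The open sets of a group topology are determined by a base of neighbourhoods of
  the identity via left translation. That the subgroups $K(\alpha)$ do define a group
  topology in this way is proved in \<open>continuous_map_mult_nsym\<close> and
  \<open>continuous_map_inv_nsym\<close>.\<close>

definition nsym_topology :: "nat \<Rightarrow> (nat \<Rightarrow> nat \<Rightarrow> nat) topology"
  where "nsym_topology n = topology (\<lambda>U. U \<subseteq> carrier (nsym n) \<and>
    (\<forall>g\<in>U. \<exists>\<alpha>. g <#\<^bsub>nsym n\<^esub> diag_stab n \<alpha> \<subseteq> U))"

lemma diag_stab_0: "diag_stab n 0 = (\<lambda>p. \<lambda>i\<in>{1..n}. p) ` carrier S_inf"
  by (simp add: diag_stab_def S_inf_stab_def)

lemma S_inf_stab_antimono: "\<alpha> \<le> \<beta> \<Longrightarrow> S_inf_stab \<beta> \<subseteq> S_inf_stab \<alpha>"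
  by (auto simp: S_inf_stab_def)

lemma diag_stab_antimono: "\<alpha> \<le> \<beta> \<Longrightarrow> diag_stab n \<beta> \<subseteq> diag_stab n \<alpha>"
  unfolding diag_stab_def by (intro image_mono S_inf_stab_antimono)

lemma S_inf_simps [simp]:
  "carrier S_inf = {p. p permutes {1..}}" "mult S_inf = (\<circ>)" "one S_inf = id"
  by (simp_all add: S_inf_def)

lemma group_S_inf: "group S_inf"
proof (rule groupI)
  fix x assume "x \<in> carrier S_inf"
  then show "\<exists>y\<in>carrier S_inf. y \<otimes>\<^bsub>S_inf\<^esub> x = \<one>\<^bsub>S_inf\<^esub>"
    by (intro bexI[of _ "Hilbert_Choice.inv x"]) (auto simp: permutes_inv permutes_inv_o)
qed (auto simp: permutes_compose permutes_id comp_assoc)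

lemma inv_S_inf: "p permutes {1..} \<Longrightarrow> inv\<^bsub>S_inf\<^esub> p = Hilbert_Choice.inv p"
  by (rule group.inv_equality[OF group_S_inf]) (auto simp: permutes_inv permutes_inv_o)

lemma subgroup_S_inf_fin: "subgroup S_inf_fin S_inf"
proof (rule group.subgroupI[OF group_S_inf])
  have "id \<in> S_inf_fin" by (simp add: S_inf_fin_def permutes_id)
  then show "S_inf_fin \<noteq> {}" by blast
next
  fix a assume a: "a \<in> S_inf_fin"
  have "{i. Hilbert_Choice.inv a i \<noteq> i} \<subseteq> {i. a i \<noteq> i}"
    using a by (auto simp: S_inf_fin_def permutes_inv_eq)
  with a show "inv\<^bsub>S_inf\<^esub> a \<in> S_inf_fin"
    by (auto simp: S_inf_fin_def inv_S_inf permutes_inv intro: finite_subset)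
next
  fix a b assume ab: "a \<in> S_inf_fin" "b \<in> S_inf_fin"
  have "{i. a (b i) \<noteq> i} \<subseteq> {i. a i \<noteq> i} \<union> {i. b i \<noteq> i}" by auto
  with ab show "a \<otimes>\<^bsub>S_inf\<^esub> b \<in> S_inf_fin"
    by (auto simp: S_inf_fin_def permutes_compose intro: finite_subset)
qed (auto simp: S_inf_fin_def)

lemma S_inf_fin_conj:
  assumes a: "a permutes {1..}" and f: "f \<in> S_inf_fin"
  shows "a \<circ> f \<circ> Hilbert_Choice.inv a \<in> S_inf_fin"
proof -
  have inva: "Hilbert_Choice.inv a (a x) = x" "a (Hilbert_Choice.inv a x) = x" for x
    using a by (auto simp: permutes_inverses)
  have "{i. (a \<circ> f \<circ> Hilbert_Choice.inv a) i \<noteq> i} \<subseteq> a ` {i. f i \<noteq> i}"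
  proof
    fix i assume i: "i \<in> {i. (a \<circ> f \<circ> Hilbert_Choice.inv a) i \<noteq> i}"
    then have "f (Hilbert_Choice.inv a i) \<noteq> Hilbert_Choice.inv a i" using inva by auto
    then show "i \<in> a ` {i. f i \<noteq> i}" by (intro image_eqI[of _ _ "Hilbert_Choice.inv a i"]) (auto simp: inva)
  qed
  then show ?thesis using a f
    by (auto simp: S_inf_fin_def permutes_compose permutes_inv intro: finite_subset)
qed

lemma carrier_nsym: "g \<in> carrier (nsym n) \<longleftrightarrow>
    g \<in> ({1..n} \<rightarrow>\<^sub>E {p. p permutes {1..}}) \<and>
    (\<forall>i\<in>{1..n}. \<forall>j\<in>{1..n}. g i \<circ> Hilbert_Choice.inv (g j) \<in> S_inf_fin)"
  by (simp add: nsym_def PiE_iff inv_S_inf cong: conj_cong)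

lemma nsym_simps [simp]:
  "mult (nsym n) = (\<lambda>x y. \<lambda>i\<in>{1..n}. x i \<circ> y i)" "one (nsym n) = (\<lambda>i\<in>{1..n}. id)"
  by (simp_all add: nsym_def)

lemma subgroup_nsym: "subgroup (carrier (nsym n)) (product_group {1..n} (\<lambda>_. S_inf))"
proof (rule group.subgroupI[OF product_group])
  show "group S_inf" by (rule group_S_inf)
  show "carrier (nsym n) \<subseteq> carrier (product_group {1..n} (\<lambda>_. S_inf))"
    by (auto simp only: carrier_nsym carrier_product_group S_inf_simps)
  have "id \<in> S_inf_fin" by (simp add: S_inf_fin_def permutes_id)
  then have "(\<lambda>i\<in>{1..n}. id) \<in> carrier (nsym n)"
    by (auto simp: carrier_nsym permutes_id)
  then show "carrier (nsym n) \<noteq> {}" by blast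
next
  fix a assume a: "a \<in> carrier (nsym n)"
  then have pa: "a i permutes {1..}" if "i \<in> {1..n}" for i using that by (auto simp: carrier_nsym PiE_iff)
  have eq: "inv\<^bsub>product_group {1..n} (\<lambda>_. S_inf)\<^esub> a = (\<lambda>i\<in>{1..n}. Hilbert_Choice.inv (a i))"
    using a by (subst inv_product_group) (auto simp: carrier_nsym group_S_inf PiE_iff inv_S_inf)
  have "Hilbert_Choice.inv (a i) \<circ> Hilbert_Choice.inv (Hilbert_Choice.inv (a j)) \<in> S_inf_fin"
    if ij: "i \<in> {1..n}" "j \<in> {1..n}" for i j
  proof -
    have "a j \<circ> Hilbert_Choice.inv (a i) \<in> S_inf_fin" using a ij by (auto simp: carrier_nsym)
    from S_inf_fin_conj[OF permutes_inv[OF pa[OF ij(2)]] this]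
    have "Hilbert_Choice.inv (a j) \<circ> (a j \<circ> Hilbert_Choice.inv (a i)) \<circ> a j \<in> S_inf_fin"
      using pa[OF ij(2)] by (simp add: permutes_inv_inv)
    moreover have "Hilbert_Choice.inv (a j) \<circ> (a j \<circ> Hilbert_Choice.inv (a i)) \<circ> a j = Hilbert_Choice.inv (a i) \<circ> a j"
      using pa[OF ij(2)] by (auto simp: fun_eq_iff permutes_inverses)
    ultimately show ?thesis using pa[OF ij(2)] by (simp add: permutes_inv_inv)
  qed
  then show "inv\<^bsub>product_group {1..n} (\<lambda>_. S_inf)\<^esub> a \<in> carrier (nsym n)"
    unfolding eq carrier_nsym using pa by (auto simp: permutes_inv)
next
  fix a b assume a: "a \<in> carrier (nsym n)" and b: "b \<in> carrier (nsym n)"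
  have pa: "a i permutes {1..}" if "i \<in> {1..n}" for i using that a by (auto simp: carrier_nsym PiE_iff)
  have pb: "b i permutes {1..}" if "i \<in> {1..n}" for i using that b by (auto simp: carrier_nsym PiE_iff)
  have "(a i \<circ> b i) \<circ> Hilbert_Choice.inv (a j \<circ> b j) \<in> S_inf_fin"
    if ij: "i \<in> {1..n}" "j \<in> {1..n}" for i j
  proof -
    have "b i \<circ> Hilbert_Choice.inv (b j) \<in> S_inf_fin" using b ij by (auto simp: carrier_nsym)
    then have 1: "a i \<circ> (b i \<circ> Hilbert_Choice.inv (b j)) \<circ> Hilbert_Choice.inv (a i) \<in> S_inf_fin"
      by (rule S_inf_fin_conj[OF pa[OF ij(1)]])
    have 2: "a i \<circ> Hilbert_Choice.inv (a j) \<in> S_inf_fin" using a ij by (auto simp: carrier_nsym)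
    have "(a i \<circ> (b i \<circ> Hilbert_Choice.inv (b j)) \<circ> Hilbert_Choice.inv (a i)) \<circ> (a i \<circ> Hilbert_Choice.inv (a j)) \<in> S_inf_fin"
      using subgroup.m_closed[OF subgroup_S_inf_fin 1 2] by simp
    moreover have "(a i \<circ> (b i \<circ> Hilbert_Choice.inv (b j)) \<circ> Hilbert_Choice.inv (a i)) \<circ> (a i \<circ> Hilbert_Choice.inv (a j))
      = (a i \<circ> b i) \<circ> Hilbert_Choice.inv (a j \<circ> b j)"
      using pa[OF ij(1)] pa[OF ij(2)] pb[OF ij(2)] by (subst o_inv_distrib) (auto simp: fun_eq_iff permutes_inverses permutes_bij)
    ultimately show ?thesis by simp
  qed
  then show "a \<otimes>\<^bsub>product_group {1..n} (\<lambda>_. S_inf)\<^esub> b \<in> carrier (nsym n)"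
    unfolding carrier_nsym using pa pb by (auto simp: permutes_compose)
qed

lemma group_nsym: "group (nsym n)"
proof -
  have "nsym n = (product_group {1..n} (\<lambda>_. S_inf))\<lparr>carrier := carrier (nsym n)\<rparr>"
    by (simp add: nsym_def)
  then show ?thesis
    using group.subgroup_imp_group[OF product_group subgroup_nsym, of n] group_S_inf by metis
qed

lemma subgroup_S_inf_stab: "subgroup (S_inf_stab \<alpha>) S_inf"
proof (rule group.subgroupI[OF group_S_inf])
  have "id \<in> S_inf_stab \<alpha>" by (simp add: S_inf_stab_def permutes_id)
  then show "S_inf_stab \<alpha> \<noteq> {}" by blast
next
  fix a assume "a \<in> S_inf_stab \<alpha>"
  then show "inv\<^bsub>S_inf\<^esub> a \<in> S_inf_stab \<alpha>"
    by (auto simp: S_inf_stab_def inv_S_inf permutes_inv permutes_inv_eq)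
qed (auto simp: S_inf_stab_def permutes_compose)

lemma subgroup_diag_stab: "subgroup (diag_stab n \<alpha>) (nsym n)"
proof -
  have "(\<lambda>p. \<lambda>i\<in>{1..n}. p) \<in> hom S_inf (nsym n)"
  proof (rule homI)
    fix p assume "p \<in> carrier S_inf"
    then have p: "p permutes {1..}" by simp
    then have "p \<circ> Hilbert_Choice.inv p = id" by (auto simp: permutes_inv_o)
    then have "p \<circ> Hilbert_Choice.inv p \<in> S_inf_fin" by (simp add: S_inf_fin_def permutes_id)
    with p show "(\<lambda>i\<in>{1..n}. p) \<in> carrier (nsym n)" by (auto simp: carrier_nsym)
  qed (auto simp: fun_eq_iff)
  then have "group_hom S_inf (nsym n) (\<lambda>p. \<lambda>i\<in>{1..n}. p)"
    by (simp add: group_hom_def group_hom_axioms_def group_S_inf group_nsym)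
  then show ?thesis
    unfolding diag_stab_def by (rule group_hom.subgroup_img_is_subgroup) (rule subgroup_S_inf_stab)
qed

lemma openin_nsym_topology: "openin (nsym_topology n) U \<longleftrightarrow> U \<subseteq> carrier (nsym n) \<and>
    (\<forall>g\<in>U. \<exists>\<alpha>. g <#\<^bsub>nsym n\<^esub> diag_stab n \<alpha> \<subseteq> U)"
proof -
  have mono: "g <#\<^bsub>nsym n\<^esub> diag_stab n \<beta> \<subseteq> g <#\<^bsub>nsym n\<^esub> diag_stab n \<alpha>" if "\<alpha> \<le> \<beta>" for g \<alpha> \<beta>
    using diag_stab_antimono[OF that, of n] by (auto simp: l_coset_def)
  have "istopology (\<lambda>U. U \<subseteq> carrier (nsym n) \<and>
    (\<forall>g\<in>U. \<exists>\<alpha>. g <#\<^bsub>nsym n\<^esub> diag_stab n \<alpha> \<subseteq> U))" (is "istopology ?P")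
    unfolding istopology_def
  proof (intro conjI allI impI)
    fix S T assume "?P S" "?P T"
    show "S \<inter> T \<subseteq> carrier (nsym n)" using \<open>?P S\<close> by blast
    show "\<forall>g\<in>S \<inter> T. \<exists>\<alpha>. g <#\<^bsub>nsym n\<^esub> diag_stab n \<alpha> \<subseteq> S \<inter> T"
    proof
      fix g assume "g \<in> S \<inter> T"
      then obtain \<alpha> \<beta> where "g <#\<^bsub>nsym n\<^esub> diag_stab n \<alpha> \<subseteq> S" "g <#\<^bsub>nsym n\<^esub> diag_stab n \<beta> \<subseteq> T"
        using \<open>?P S\<close> \<open>?P T\<close> by blast
      with mono[of \<alpha> "max \<alpha> \<beta>" g] mono[of \<beta> "max \<alpha> \<beta>" g]
      show "\<exists>\<alpha>. g <#\<^bsub>nsym n\<^esub> diag_stab n \<alpha> \<subseteq> S \<inter> T"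
        by (intro exI[of _ "max \<alpha> \<beta>"]) auto
    qed
  next
    fix \<K> assume *: "\<forall>K\<in>\<K>. ?P K"
    then show "\<Union>\<K> \<subseteq> carrier (nsym n)" by blast
    show "\<forall>g\<in>\<Union>\<K>. \<exists>\<alpha>. g <#\<^bsub>nsym n\<^esub> diag_stab n \<alpha> \<subseteq> \<Union>\<K>"
      using * by (meson UnionE Union_upper order_trans)
  qed
  then show ?thesis by (simp add: nsym_topology_def topology_inverse')
qed

lemma topspace_nsym_topology [simp]: "topspace (nsym_topology n) = carrier (nsym n)"
proof (rule antisym)
  show "topspace (nsym_topology n) \<subseteq> carrier (nsym n)"
    using openin_topspace openin_nsym_topology by blast
  have "openin (nsym_topology n) (carrier (nsym n))"
    unfolding openin_nsym_topology
    using group.l_coset_subset_G[OF group_nsym] subgroup.subset[OF subgroup_diag_stab] by blast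
  then show "carrier (nsym n) \<subseteq> topspace (nsym_topology n)" by (rule openin_subset)
qed

lemma mem_coset_diag_stab:
  assumes g: "g \<in> carrier (nsym n)"
  shows "g \<in> g <#\<^bsub>nsym n\<^esub> diag_stab n \<alpha>"
proof -
  interpret group "nsym n" by (rule group_nsym)
  show ?thesis
    using subgroup.one_closed[OF subgroup_diag_stab, of n \<alpha>] r_one[OF g]
    unfolding l_coset_def by (metis (mono_tags, lifting) UN_iff singletonI)
qed

lemma openin_coset_diag_stab:
  assumes g: "g \<in> carrier (nsym n)"
  shows "openin (nsym_topology n) (g <#\<^bsub>nsym n\<^esub> diag_stab n \<alpha>)"
  unfolding openin_nsym_topology
proof (intro conjI ballI exI)
  interpret group "nsym n" by (rule group_nsym)
  show "g <#\<^bsub>nsym n\<^esub> diag_stab n \<alpha> \<subseteq> carrier (nsym n)"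
    using g subgroup.subset[OF subgroup_diag_stab] by (rule l_coset_subset_G[rotated])
  fix h assume "h \<in> g <#\<^bsub>nsym n\<^esub> diag_stab n \<alpha>"
  then show "h <#\<^bsub>nsym n\<^esub> diag_stab n \<alpha> \<subseteq> g <#\<^bsub>nsym n\<^esub> diag_stab n \<alpha>"
    using l_repr_independence[OF _ g subgroup_diag_stab] by blast
qed

lemma openin_diag_stab: "openin (nsym_topology n) (diag_stab n \<alpha>)"
proof -
  interpret group "nsym n" by (rule group_nsym)
  have "\<one>\<^bsub>nsym n\<^esub> <#\<^bsub>nsym n\<^esub> diag_stab n \<alpha> = diag_stab n \<alpha>"
    by (rule lcos_mult_one[OF subgroup.subset[OF subgroup_diag_stab]])
  then show ?thesis using openin_coset_diag_stab[OF one_closed] by metis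
qed

lemma diag_stab_base_at_one:
  assumes "openin (nsym_topology n) U" "\<one>\<^bsub>nsym n\<^esub> \<in> U"
  shows "\<exists>\<alpha>. diag_stab n \<alpha> \<subseteq> U"
proof -
  interpret group "nsym n" by (rule group_nsym)
  have "\<one>\<^bsub>nsym n\<^esub> <#\<^bsub>nsym n\<^esub> diag_stab n \<alpha> = diag_stab n \<alpha>" for \<alpha>
    by (rule lcos_mult_one[OF subgroup.subset[OF subgroup_diag_stab]])
  then show ?thesis using assms unfolding openin_nsym_topology by metis
qed

lemma diag_stab_conj:
  assumes g: "g \<in> carrier (nsym n)"
  shows "\<exists>\<beta>. \<forall>k\<in>diag_stab n \<beta>. g \<otimes>\<^bsub>nsym n\<^esub> k \<otimes>\<^bsub>nsym n\<^esub> inv\<^bsub>nsym n\<^esub> g \<in> diag_stab n \<alpha>"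
proof (cases "n = 0")
  case True
  have "id \<in> S_inf_stab \<alpha>" by (simp add: S_inf_stab_def permutes_id)
  then have "(\<lambda>i\<in>{1..n}. id) \<in> diag_stab n \<alpha>" by (simp add: diag_stab_def)
  then have "(\<lambda>i\<in>{1..n}. f i) \<in> diag_stab n \<alpha>" for f
    using True by (simp add: restrict_def)
  then show ?thesis unfolding nsym_simps by blast
next
  case False
  interpret group "nsym n" by (rule group_nsym)
  define a where "a = g 1"
  have pg: "g i permutes {1..}" if "i \<in> {1..n}" for i using that g by (auto simp: carrier_nsym PiE_iff)
  have pa: "a permutes {1..}" using pg[of 1] False by (simp add: a_def)
  let ?M = "\<lambda>i. {x. (g i \<circ> Hilbert_Choice.inv a) x \<noteq> x}"
  have finM: "finite (\<Union>i\<in>{1..n}. Hilbert_Choice.inv a ` ?M i)"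
    using g False by (auto simp: carrier_nsym S_inf_fin_def a_def)
  then have "finite (Hilbert_Choice.inv a ` {1..\<alpha>} \<union> (\<Union>i\<in>{1..n}. Hilbert_Choice.inv a ` ?M i))"
    by simp
  then obtain \<beta> where \<beta>: "x \<le> \<beta>" if "x \<in> Hilbert_Choice.inv a ` {1..\<alpha>} \<union> (\<Union>i\<in>{1..n}. Hilbert_Choice.inv a ` ?M i)" for x
    by (meson finite_nat_set_iff_bounded_le)
  show ?thesis
  proof (intro exI ballI)
    fix k assume "k \<in> diag_stab n \<beta>"
    then obtain p where p: "p permutes {1..}" and pfix: "\<And>x. x \<le> \<beta> \<Longrightarrow> p x = x" and k: "k = (\<lambda>i\<in>{1..n}. p)"
      by (auto simp: diag_stab_def S_inf_stab_def) (metis Suc_leI atLeastAtMost_iff gr0I permutes_not_in atLeast_iff)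
    let ?q = "a \<circ> p \<circ> Hilbert_Choice.inv a"
    have q: "?q permutes {1..}" using pa p by (intro permutes_compose permutes_inv)
    have "?q x = x" if "x \<in> {1..\<alpha>}" for x
      using pfix[OF \<beta>[of "Hilbert_Choice.inv a x"]] that pa by (auto simp: permutes_inverses)
    with q have qs: "?q \<in> S_inf_stab \<alpha>" by (auto simp: S_inf_stab_def)
    have gi: "g i \<circ> p = ?q \<circ> g i" if i: "i \<in> {1..n}" for i
    proof
      fix x
      have fixed: "g i y = a y" if "\<not> y \<le> \<beta>" for y
      proof (rule ccontr)
        assume "g i y \<noteq> a y"
        then have "a y \<in> ?M i" using pa by (auto simp: permutes_inverses)
        then have "Hilbert_Choice.inv a (a y) \<in> Hilbert_Choice.inv a ` ?M i" by blast
        then have "y \<in> Hilbert_Choice.inv a ` ?M i" using pa by (simp add: permutes_inverses)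
        then show False using \<beta>[of y] i that by blast
      qed
      show "(g i \<circ> p) x = (?q \<circ> g i) x"
      proof (cases "x \<le> \<beta>")
        case False
        then have "\<not> p x \<le> \<beta>" by (metis pfix p permutes_inverses(2))
        then show ?thesis using False fixed pa by (auto simp: permutes_inverses)
      next
        case True
        define y where "y = Hilbert_Choice.inv a (g i x)"
        have y: "a y = g i x" using pa by (simp add: y_def permutes_inverses)
        have "y \<le> \<beta>"
        proof (rule ccontr)
          assume "\<not> y \<le> \<beta>"
          then have "g i y = g i x" using fixed y by simp
          then have "y = x" using pg[OF i] by (metis permutes_inverses(2))
          then show False using True \<open>\<not> y \<le> \<beta>\<close> by simp
        qed
        then show ?thesis using True pfix y by (simp add: y_def)
      qed
    qed
    have qd: "(\<lambda>i\<in>{1..n}. ?q) \<in> diag_stab n \<alpha>" using qs by (auto simp: diag_stab_def)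
    then have qc: "(\<lambda>i\<in>{1..n}. ?q) \<in> carrier (nsym n)"
      using subgroup.subset[OF subgroup_diag_stab] by blast
    have "g \<otimes>\<^bsub>nsym n\<^esub> k = (\<lambda>i\<in>{1..n}. ?q) \<otimes>\<^bsub>nsym n\<^esub> g"
      using gi by (auto simp: k fun_eq_iff)
    then have "g \<otimes>\<^bsub>nsym n\<^esub> k \<otimes>\<^bsub>nsym n\<^esub> inv\<^bsub>nsym n\<^esub> g = (\<lambda>i\<in>{1..n}. ?q)"
      using g qc m_assoc[OF qc g inv_closed[OF g]] r_inv[OF g] r_one[OF qc] by metis
    then show "g \<otimes>\<^bsub>nsym n\<^esub> k \<otimes>\<^bsub>nsym n\<^esub> inv\<^bsub>nsym n\<^esub> g \<in> diag_stab n \<alpha>" using qd by simp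
  qed
qed

lemma continuous_map_inv_nsym:
  "continuous_map (nsym_topology n) (nsym_topology n) (\<lambda>g. inv\<^bsub>nsym n\<^esub> g)"
proof -
  interpret group "nsym n" by (rule group_nsym)
  note sub = subgroup_diag_stab
  have "\<exists>U. openin (nsym_topology n) U \<and> g \<in> U \<and> (\<forall>h\<in>U. inv\<^bsub>nsym n\<^esub> h \<in> V)"
    if g: "g \<in> carrier (nsym n)" and V: "openin (nsym_topology n) V" "inv\<^bsub>nsym n\<^esub> g \<in> V" for g V
  proof -
    obtain \<alpha> where \<alpha>: "inv\<^bsub>nsym n\<^esub> g <#\<^bsub>nsym n\<^esub> diag_stab n \<alpha> \<subseteq> V"
      using V by (auto simp: openin_nsym_topology)
    obtain \<beta> where \<beta>: "\<And>k. k \<in> diag_stab n \<beta> \<Longrightarrow> g \<otimes>\<^bsub>nsym n\<^esub> k \<otimes>\<^bsub>nsym n\<^esub> inv\<^bsub>nsym n\<^esub> g \<in> diag_stab n \<alpha>"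
      using diag_stab_conj[OF g] by blast
    show ?thesis
    proof (intro exI[of _ "g <#\<^bsub>nsym n\<^esub> diag_stab n \<beta>"] conjI ballI)
      show "g \<in> g <#\<^bsub>nsym n\<^esub> diag_stab n \<beta>" by (rule mem_coset_diag_stab[OF g])
      fix h assume "h \<in> g <#\<^bsub>nsym n\<^esub> diag_stab n \<beta>"
      then obtain k where k: "k \<in> diag_stab n \<beta>" and h: "h = g \<otimes>\<^bsub>nsym n\<^esub> k" by (auto simp: l_coset_def)
      have kc: "k \<in> carrier (nsym n)" using k subgroup.subset[OF sub] by blast
      have ik: "inv\<^bsub>nsym n\<^esub> k \<in> diag_stab n \<beta>" using k by (rule subgroup.m_inv_closed[OF sub])
      let ?x = "g \<otimes>\<^bsub>nsym n\<^esub> inv\<^bsub>nsym n\<^esub> k \<otimes>\<^bsub>nsym n\<^esub> inv\<^bsub>nsym n\<^esub> g"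
      have "inv\<^bsub>nsym n\<^esub> h = inv\<^bsub>nsym n\<^esub> k \<otimes>\<^bsub>nsym n\<^esub> inv\<^bsub>nsym n\<^esub> g"
        unfolding h by (rule inv_mult_group[OF g kc])
      also have "\<dots> = inv\<^bsub>nsym n\<^esub> g \<otimes>\<^bsub>nsym n\<^esub> ?x"
        using g kc by (metis inv_closed m_assoc m_closed l_inv l_one)
      finally show "inv\<^bsub>nsym n\<^esub> h \<in> V" using \<alpha> \<beta>[OF ik] by (force simp only: l_coset_def)
    qed (rule openin_coset_diag_stab[OF g])
  qed
  then show ?thesis
    unfolding continuous_map_eq_topcontinuous_at topcontinuous_at_def by auto
qed

lemma continuous_map_mult_nsym:
  "continuous_map (prod_topology (nsym_topology n) (nsym_topology n)) (nsym_topology n)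
     (\<lambda>(g, h). g \<otimes>\<^bsub>nsym n\<^esub> h)"
proof -
  interpret group "nsym n" by (rule group_nsym)
  note sub = subgroup_diag_stab
  have "\<exists>U. openin (prod_topology (nsym_topology n) (nsym_topology n)) U \<and> (g, h) \<in> U \<and>
      (\<forall>(x, y)\<in>U. x \<otimes>\<^bsub>nsym n\<^esub> y \<in> V)"
    if g: "g \<in> carrier (nsym n)" and h: "h \<in> carrier (nsym n)"
      and V: "openin (nsym_topology n) V" "g \<otimes>\<^bsub>nsym n\<^esub> h \<in> V" for g h V
  proof -
    obtain \<alpha> where \<alpha>: "(g \<otimes>\<^bsub>nsym n\<^esub> h) <#\<^bsub>nsym n\<^esub> diag_stab n \<alpha> \<subseteq> V"
      using V by (auto simp: openin_nsym_topology)
    have ih: "inv\<^bsub>nsym n\<^esub> h \<in> carrier (nsym n)" using h by simp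
    obtain \<beta> where \<beta>: "\<And>k. k \<in> diag_stab n \<beta> \<Longrightarrow> inv\<^bsub>nsym n\<^esub> h \<otimes>\<^bsub>nsym n\<^esub> k \<otimes>\<^bsub>nsym n\<^esub> h \<in> diag_stab n \<alpha>"
      using diag_stab_conj[OF ih] inv_inv[OF h] by metis
    show ?thesis
    proof (intro exI[of _ "(g <#\<^bsub>nsym n\<^esub> diag_stab n \<beta>) \<times> (h <#\<^bsub>nsym n\<^esub> diag_stab n \<alpha>)"] conjI)
      show "openin (prod_topology (nsym_topology n) (nsym_topology n))
          ((g <#\<^bsub>nsym n\<^esub> diag_stab n \<beta>) \<times> (h <#\<^bsub>nsym n\<^esub> diag_stab n \<alpha>))"
        using openin_coset_diag_stab g h by (simp add: openin_prod_Times_iff)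
      show "(g, h) \<in> (g <#\<^bsub>nsym n\<^esub> diag_stab n \<beta>) \<times> (h <#\<^bsub>nsym n\<^esub> diag_stab n \<alpha>)"
        using mem_coset_diag_stab[OF g] mem_coset_diag_stab[OF h] by blast
      have "x \<otimes>\<^bsub>nsym n\<^esub> y \<in> V"
        if xy: "x \<in> g <#\<^bsub>nsym n\<^esub> diag_stab n \<beta>" "y \<in> h <#\<^bsub>nsym n\<^esub> diag_stab n \<alpha>" for x y
      proof -
        obtain k l where k: "k \<in> diag_stab n \<beta>" "x = g \<otimes>\<^bsub>nsym n\<^esub> k"
          and l: "l \<in> diag_stab n \<alpha>" "y = h \<otimes>\<^bsub>nsym n\<^esub> l" using xy unfolding l_coset_def by blast
        have kc: "k \<in> carrier (nsym n)" and lc: "l \<in> carrier (nsym n)"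
          using k l subgroup.subset[OF sub] by blast+
        let ?x = "inv\<^bsub>nsym n\<^esub> h \<otimes>\<^bsub>nsym n\<^esub> k \<otimes>\<^bsub>nsym n\<^esub> h"
        have xc: "?x \<in> carrier (nsym n)" using h kc by (intro m_closed inv_closed)
        have "h \<otimes>\<^bsub>nsym n\<^esub> ?x = k \<otimes>\<^bsub>nsym n\<^esub> h"
          using h kc by (metis inv_closed m_assoc m_closed r_inv l_one)
        then have "x \<otimes>\<^bsub>nsym n\<^esub> y = (g \<otimes>\<^bsub>nsym n\<^esub> h) \<otimes>\<^bsub>nsym n\<^esub> (?x \<otimes>\<^bsub>nsym n\<^esub> l)"
          unfolding k(2) l(2) using g h kc lc xc by (metis m_assoc m_closed)
        moreover have "?x \<otimes>\<^bsub>nsym n\<^esub> l \<in> diag_stab n \<alpha>"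
          using subgroup.m_closed[OF sub \<beta>[OF k(1)] l(1)] .
        ultimately show ?thesis using \<alpha> by (force simp only: l_coset_def)
      qed
      then show "\<forall>(x, y)\<in>(g <#\<^bsub>nsym n\<^esub> diag_stab n \<beta>) \<times> (h <#\<^bsub>nsym n\<^esub> diag_stab n \<alpha>).
          x \<otimes>\<^bsub>nsym n\<^esub> y \<in> V" by blast
    qed
  qed
  then show ?thesis
    unfolding continuous_map_eq_topcontinuous_at topcontinuous_at_def
    by (auto simp del: nsym_simps simp: case_prod_unfold)
qed


section \<open>Unitary representations in complex Hilbert spaces\<close>

text \<open>The underlying real inner product is required to be the real part of the complex one,
  so that norm, topology and completeness are those of the complex inner product.
  The latter is linear in the first argument.\<close>

class complex_hilbert_space = real_inner + complete_space +
  fixes scaleC :: "complex \<Rightarrow> 'a \<Rightarrow> 'a" (infixr \<open>*\<^sub>C\<close> 75)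
    and cinner :: "'a \<Rightarrow> 'a \<Rightarrow> complex"
  assumes scaleC_add_right: "c *\<^sub>C (x + y) = c *\<^sub>C x + c *\<^sub>C y"
    and scaleC_add_left: "(c + d) *\<^sub>C x = c *\<^sub>C x + d *\<^sub>C x"
    and scaleC_scaleC: "c *\<^sub>C d *\<^sub>C x = (c * d) *\<^sub>C x"
    and scaleR_scaleC: "r *\<^sub>R x = complex_of_real r *\<^sub>C x"
    and cinner_commute: "cinner x y = cnj (cinner y x)"
    and cinner_add_left: "cinner (x + y) z = cinner x z + cinner y z"
    and cinner_scaleC_left: "cinner (c *\<^sub>C x) y = c * cinner x y"
    and inner_eq_Re_cinner: "inner x y = Re (cinner x y)"

instantiation complex :: complex_hilbert_space
begin
definition scaleC_complex :: "complex \<Rightarrow> complex \<Rightarrow> complex" where "scaleC_complex c x = c * x"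
definition cinner_complex :: "complex \<Rightarrow> complex \<Rightarrow> complex" where "cinner_complex x y = x * cnj y"
instance
  by standard (auto simp: scaleC_complex_def cinner_complex_def algebra_simps scaleR_conv_of_real
      inner_complex_def)
end

global_interpretation complex_vector:
  vector_space "scaleC :: complex \<Rightarrow> 'a \<Rightarrow> 'a :: complex_hilbert_space"
proof
  show "1 *\<^sub>C x = x" for x :: 'a
    using scaleR_scaleC[of 1 x] by simp
qed (simp_all add: scaleC_add_right scaleC_add_left scaleC_scaleC)

definition unitary_group :: "('a :: complex_hilbert_space \<Rightarrow> 'a) monoid"
  where "unitary_group = \<lparr>carrier = {U. Vector_Spaces.linear scaleC scaleC U \<and> surj U \<and>
      (\<forall>x y. cinner (U x) (U y) = cinner x y)}, mult = (\<circ>), one = id\<rparr>"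

definition unitary_rep ::
    "('g, 'm) monoid_scheme \<Rightarrow> 'g topology \<Rightarrow> ('g \<Rightarrow> 'a \<Rightarrow> 'a :: complex_hilbert_space) \<Rightarrow> bool"
  where "unitary_rep G T \<rho> \<longleftrightarrow> \<rho> \<in> hom G unitary_group \<and>
    (\<forall>v. continuous_map T euclidean (\<lambda>g. \<rho> g v))"

definition irreducible_rep ::
    "('g, 'm) monoid_scheme \<Rightarrow> ('g \<Rightarrow> 'a \<Rightarrow> 'a :: complex_hilbert_space) \<Rightarrow> bool"
  where "irreducible_rep G \<rho> \<longleftrightarrow> (UNIV :: 'a set) \<noteq> {0} \<and>
    (\<forall>V. complex_vector.subspace V \<and> closed V \<and> (\<forall>g\<in>carrier G. \<rho> g ` V \<subseteq> V) \<longrightarrow>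
      V = {0} \<or> V = UNIV)"

definition fixed_vectors :: "'g set \<Rightarrow> ('g \<Rightarrow> 'a \<Rightarrow> 'a) \<Rightarrow> 'a set"
  where "fixed_vectors K \<rho> = {v. \<forall>k\<in>K. \<rho> k v = v}"

text \<open>The library's dimension is \<open>0\<close> for infinite-dimensional spaces, so finite
  dimension has to be stated in addition to the bound.\<close>

definition cdim_le :: "'a :: complex_hilbert_space set \<Rightarrow> nat \<Rightarrow> bool"
  where "cdim_le V d \<longleftrightarrow>
    (\<exists>B. finite B \<and> complex_vector.span B = V) \<and> complex_vector.dim V \<le> d"

end

theory Submission
  imports Defs
begin

text \<open>
  Let $P$ be the orthogonal projection onto $H(0)$. If $x$ and $y$ are fixed by $K(m)$, then
  $\langle \rho(p) x, \rho(q) y\rangle$ is the same for all $p, q \in K$ that move $\{1,\dots,m\}$ to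
  disjoint sets, because finite partial injections extend to permutations. Averaging over infinitely
  many disjoint translates identifies this number as $\langle P x, y\rangle$. Up to right
  multiplication by $K$ all tuples are finitely supported, so
  $P\rho(g)P\rho(h)P = P\rho(g h')P$ where $h'$ is a conjugate of $h$ by an element of $K$ with
  support disjoint from that of $g$. Then $g$ and $h'$ commute, hence so do the
  operators $P\rho(g)P$. By irreducibility every nonzero vector of $H(0)$ is cyclic for
  them, and Schur's lemma makes them scalar on $H(0)$. So for a nonzero $v \in H(0)$ the projections
  of its orbit, which span a dense subspace of $H(0)$, all lie on the line through $v$.
\<close>

section \<open>Hilbert space preliminaries\<close>

text \<open>A sequence in \<open>M\<close> minimising the distance to \<open>x\<close> is Cauchy,
  and its limit is the foot of the perpendicular.\<close>

lemma orthogonal_projection_exists: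
  fixes M :: "'a::{real_inner,banach} set"
  assumes M: "subspace M" "closed M"
  shows "\<exists>p\<in>M. \<forall>y\<in>M. inner (x - p) y = 0"
proof -
  define d where "d = (INF y\<in>M. (norm (x - y))\<^sup>2)"
  have M0: "0 \<in> M" using M by (simp add: subspace_0)
  have bdd: "bdd_below ((\<lambda>y. (norm (x - y))\<^sup>2) ` M)"
    by (intro bdd_belowI2[of _ 0]) simp
  have d_le: "d \<le> (norm (x - y))\<^sup>2" if "y \<in> M" for y
    unfolding d_def using bdd that by (rule cINF_lower)
  have "\<exists>y\<in>M. (norm (x - y))\<^sup>2 < d + 1 / real (Suc k)" for k
    using cINF_less_iff[OF _ bdd, of "d + 1 / real (Suc k)"] M0 by (auto simp: d_def)
  then obtain y where yM: "\<And>k. y k \<in> M" and y: "\<And>k. (norm (x - y k))\<^sup>2 < d + 1 / real (Suc k)"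
    by metis
  have bound: "(norm (y k - y l))\<^sup>2 \<le> 4 / real (Suc N)" if "N \<le> k" "N \<le> l" for N k l
  proof -
    \<comment> \<open>The midpoint of \<open>y k\<close> and \<open>y l\<close> lies in
      \<open>M\<close>, so its squared distance to \<open>x\<close> is at least \<open>d\<close>;
      the parallelogram law then bounds the distance between \<open>y k\<close> and
      \<open>y l\<close>.\<close>
    have "(1/2) *\<^sub>R (y k + y l) \<in> M"
      using M yM by (simp add: subspace_add subspace_scale)
    from d_le[OF this] have "4 * d \<le> 4 * (norm (x - (1/2) *\<^sub>R (y k + y l)))\<^sup>2" by simp
    also have "\<dots> = 2 * (norm (x - y k))\<^sup>2 + 2 * (norm (x - y l))\<^sup>2 - (norm (y k - y l))\<^sup>2"
      unfolding power2_norm_eq_inner by (simp add: inner_simps inner_commute)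
    finally have "(norm (y k - y l))\<^sup>2 \<le> 2 / real (Suc k) + 2 / real (Suc l)"
      using y[of k] y[of l] by simp
    also have "\<dots> \<le> 2 / real (Suc N) + 2 / real (Suc N)"
      using that by (intro add_mono divide_left_mono) auto
    finally show ?thesis by simp
  qed
  have "Cauchy y"
  proof (rule metric_CauchyI)
    fix e :: real assume "e > 0"
    obtain N where N: "4 / e\<^sup>2 < real N" using reals_Archimedean2 by blast
    have "dist (y k) (y l) < e" if "N \<le> k" "N \<le> l" for k l
    proof -
      have "4 / e\<^sup>2 < real (Suc N)" using N by simp
      then have "4 / real (Suc N) < e\<^sup>2"
        using \<open>e > 0\<close> by (simp add: divide_less_eq mult.commute)
      with bound[OF that] have "(norm (y k - y l))\<^sup>2 < e\<^sup>2" by linarith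
      then show ?thesis
        using \<open>e > 0\<close> by (simp add: dist_norm power_less_imp_less_base)
    qed
    then show "\<exists>N. \<forall>k\<ge>N. \<forall>l\<ge>N. dist (y k) (y l) < e" by blast
  qed
  then obtain p where p: "y \<longlonglongrightarrow> p" using Cauchy_convergent convergent_def by blast
  have pM: "p \<in> M" using M(2) yM p by (metis closed_sequentially)
  have "(\<lambda>k. (norm (x - y k))\<^sup>2) \<longlonglongrightarrow> (norm (x - p))\<^sup>2"
    by (intro tendsto_intros p)
  moreover have "(\<lambda>k. d + 1 / real (Suc k)) \<longlonglongrightarrow> d + 0"
    by (intro tendsto_intros LIMSEQ_Suc[OF lim_1_over_n])
  ultimately have pd: "(norm (x - p))\<^sup>2 \<le> d"
    using y by (intro LIMSEQ_le[of _ _ _ d]) (auto intro: less_imp_le)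
  have "inner (x - p) z = 0" if z: "z \<in> M" for z
  proof (cases "z = 0")
    case False
    \<comment> \<open>This \<open>t\<close> minimises the distance of \<open>x\<close> to the line
      through \<open>p\<close> in direction \<open>z\<close>. Since \<open>p\<close> is already
      optimal, the gain, the squared inner product over \<open>inner z z\<close>, must be
      zero.\<close>
    define t where "t = inner (x - p) z / inner z z"
    have "p + t *\<^sub>R z \<in> M" using M pM z by (simp add: subspace_add subspace_scale)
    from d_le[OF this] pd have "(norm (x - p))\<^sup>2 \<le> (norm ((x - p) - t *\<^sub>R z))\<^sup>2"
      unfolding diff_diff_eq by (rule order_trans[rotated])
    also have "\<dots> = (norm (x - p))\<^sup>2 - 2 * t * inner (x - p) z + t\<^sup>2 * inner z z"
      unfolding power2_norm_eq_inner by (simp add: inner_diff_left inner_diff_right inner_commute power2_eq_square algebra_simps)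
    also have "\<dots> = (norm (x - p))\<^sup>2 - (inner (x - p) z)\<^sup>2 / inner z z"
      using False by (simp add: t_def power2_eq_square field_simps)
    finally have "(inner (x - p) z)\<^sup>2 / inner z z \<le> 0" by simp
    then show ?thesis using False
      by (simp add: divide_le_0_iff) (metis False inner_eq_zero_iff inner_ge_zero order_antisym)
  qed simp
  with pM show ?thesis by blast
qed

section \<open>Limits of averages of equiangular sequences\<close>

lemma Cesaro_eventually_const:
  fixes f :: "nat \<Rightarrow> real"
  assumes "\<forall>\<^sub>F j in sequentially. f j = a"
  shows "(\<lambda>N. (\<Sum>j<Suc N. f j) / real (Suc N)) \<longlonglongrightarrow> a"
proof -
  obtain N0 where N0: "\<And>j. j \<ge> N0 \<Longrightarrow> f j = a"
    using assms by (auto simp: eventually_sequentially)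
  define C where "C = (\<Sum>j<N0. f j - a)"
  have "(\<Sum>j<Suc N. f j) / real (Suc N) = a + C / real (Suc N)" if "N \<ge> N0" for N
  proof -
    have "(\<Sum>j<Suc N. f j - a) = C"
      unfolding C_def using that N0 by (intro sum.mono_neutral_right) auto
    then have "(\<Sum>j<Suc N. f j) = real (Suc N) * a + C"
      by (simp add: sum_subtractf del: sum.lessThan_Suc)
    then show ?thesis by (simp add: field_simps)
  qed
  then have "\<forall>\<^sub>F N in sequentially. a + C * (1 / real (Suc N)) = (\<Sum>j<Suc N. f j) / real (Suc N)"
    by (intro eventually_sequentiallyI[of N0]) simp
  moreover have "(\<lambda>N. a + C * (1 / real (Suc N))) \<longlonglongrightarrow> a + C * 0"
    by (intro tendsto_intros LIMSEQ_Suc[OF lim_1_over_n])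
  ultimately show ?thesis by (simp add: filterlim_cong)
qed

text \<open>The averages of \<open>x\<close> converge in norm, because all off-diagonal Gram entries
  agree. Pairings with \<open>x j\<close> that are eventually constant keep their value under
  averaging, so the limit \<open>u\<close> acts as a weak limit without any compactness
  argument.\<close>

lemma equiangular_weak_limit:
  fixes x :: "nat \<Rightarrow> 'a::{real_inner,banach}"
  assumes x: "\<And>i j. inner (x i) (x j) = (if i = j then d else c)"
  obtains u where "\<And>y a. \<forall>\<^sub>F j in sequentially. inner (x j) y = a \<Longrightarrow> inner u y = a"
proof -
  define s where "s N = (\<Sum>j<Suc N. x j)" for N
  define u where "u N = (1 / real (Suc N)) *\<^sub>R s N" for N
  have ss: "inner (s N) (s M) = real (Suc N) * real (Suc M) * c + real (Suc N) * (d - c)"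
    if "N \<le> M" for N M
  proof -
    have "inner (s N) (s M) = (\<Sum>i<Suc N. inner (x i) (s M))"
      by (simp only: s_def inner_sum_left)
    also have "\<dots> = (\<Sum>i<Suc N. \<Sum>j<Suc M. c + (if i = j then d - c else 0))"
      by (intro sum.cong refl) (simp add: s_def inner_sum_right x if_distrib cong: if_cong del: sum.lessThan_Suc)
    also have "\<dots> = (\<Sum>i<Suc N. real (Suc M) * c + (d - c))"
      using that by (intro sum.cong refl) (simp add: sum.distrib del: sum.lessThan_Suc)
    finally show ?thesis by (simp add: algebra_simps del: sum.lessThan_Suc)
  qed
  \<comment> \<open>The value depends only on the larger index, so the squared distance of two
    averages is a difference of two terms of a null sequence.\<close>
  have uu: "inner (u N) (u M) = c + (d - c) / real (Suc M)" if "N \<le> M" for N M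
  proof -
    have "inner (u N) (u M) = inner (s N) (s M) / (real (Suc N) * real (Suc M))"
      by (simp add: u_def)
    then show ?thesis unfolding ss[OF that] by (simp add: add_divide_distrib del: of_nat_Suc)
  qed
  have diff: "(norm (u N - u M))\<^sup>2 \<le> \<bar>d - c\<bar> / real (Suc N)" if "N \<le> M" for N M
  proof -
    have "(norm (u N - u M))\<^sup>2 = (d - c) * (1 / real (Suc N) - 1 / real (Suc M))"
      unfolding power2_norm_eq_inner
      using uu[of N N] uu[of M M] uu[OF that]
      by (simp add: inner_diff_left inner_diff_right inner_commute algebra_simps)
    also have "\<dots> \<le> \<bar>d - c\<bar> * (1 / real (Suc N))"
      using that by (intro mult_mono) (auto simp: frac_le)
    finally show ?thesis by simp
  qed
  have "Cauchy u"
  proof (rule CauchyI')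
    fix e :: real assume "e > 0"
    obtain N where N: "\<bar>d - c\<bar> / e\<^sup>2 < real N" using reals_Archimedean2 by blast
    have "dist (u k) (u l) < e" if "N \<le> k" "k < l" for k l
    proof -
      have "(norm (u k - u l))\<^sup>2 \<le> \<bar>d - c\<bar> / real (Suc k)" using diff that by simp
      also have "\<dots> < e\<^sup>2"
      proof -
        have "\<bar>d - c\<bar> / e\<^sup>2 < real (Suc k)" using N that by linarith
        then show ?thesis using \<open>e > 0\<close> by (simp add: divide_less_eq mult.commute)
      qed
      finally show ?thesis
        using \<open>e > 0\<close> by (simp add: dist_norm power_less_imp_less_base)
    qed
    then show "\<exists>M. \<forall>m\<ge>M. \<forall>n>m. dist (u m) (u n) < e" by blast
  qed
  then obtain v where v: "u \<longlonglongrightarrow> v" using Cauchy_convergent convergent_def by blast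
  show ?thesis
  proof (rule that[of v])
    fix y a assume "\<forall>\<^sub>F j in sequentially. inner (x j) y = a"
    from Cesaro_eventually_const[OF this]
    have "(\<lambda>N. inner (u N) y) \<longlonglongrightarrow> a"
      by (simp add: u_def s_def inner_sum_left del: sum.lessThan_Suc)
    moreover have "(\<lambda>N. inner (u N) y) \<longlonglongrightarrow> inner v y" by (intro tendsto_intros v)
    ultimately show "inner v y = a" using LIMSEQ_unique by blast
  qed
qed

section \<open>Absolute values of self-adjoint operators\<close>

text \<open>$1 - Y$ is a square root of $1 - B$, computed by the iteration $Y \mapsto (B + Y^2)/2$. The same
  iteration for real numbers with $B = 1$ majorizes it, whence convergence.\<close>

lemma contraction_quadratic_root:
  fixes B :: "'a::banach \<Rightarrow>\<^sub>L 'a"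
  assumes B: "norm B \<le> 1"
  obtains Y where "norm Y \<le> 1" "2 *\<^sub>R Y = B + (Y o\<^sub>L Y)"
    "\<And>S. S o\<^sub>L B = B o\<^sub>L S \<Longrightarrow> S o\<^sub>L Y = Y o\<^sub>L S"
proof -
  note bil = bounded_bilinear.add_left[OF bounded_bilinear_blinfun_compose]
    bounded_bilinear.add_right[OF bounded_bilinear_blinfun_compose]
    bounded_bilinear.diff_left[OF bounded_bilinear_blinfun_compose]
    bounded_bilinear.diff_right[OF bounded_bilinear_blinfun_compose]
    bounded_bilinear.scaleR_left[OF bounded_bilinear_blinfun_compose]
    bounded_bilinear.scaleR_right[OF bounded_bilinear_blinfun_compose]
  define Y where "Y = rec_nat (0 :: 'a \<Rightarrow>\<^sub>L 'a) (\<lambda>_ Z. (1/2) *\<^sub>R (B + (Z o\<^sub>L Z)))"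
  have Y0: "Y 0 = 0" and YS: "\<And>n. Y (Suc n) = (1/2) *\<^sub>R (B + (Y n o\<^sub>L Y n))"
    by (simp_all add: Y_def)
  define y where "y = rec_nat (0 :: real) (\<lambda>_ z. (1 + z\<^sup>2) / 2)"
  have y0: "y 0 = 0" and yS: "\<And>n. y (Suc n) = (1 + (y n)\<^sup>2) / 2"
    by (simp_all add: y_def)
  have y01: "0 \<le> y n \<and> y n \<le> 1" for n
    by (induction n) (auto simp: y0 yS abs_square_le_1)
  have ymono: "y n \<le> y (Suc n)" for n
    \<comment> \<open>Each increment of \<open>y\<close> equals half the square of
      \<open>y n - 1\<close>.\<close>
    using zero_le_power2[of "y n - 1"] by (simp add: yS power2_diff)
  have Yy: "norm (Y n) \<le> y n" for n
  proof (induction n)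
    case (Suc n)
    have "norm (B + (Y n o\<^sub>L Y n)) \<le> norm B + norm (Y n) * norm (Y n)"
      by (rule order_trans[OF norm_triangle_ineq]) (simp add: norm_blinfun_compose)
    also have "\<dots> \<le> 1 + y n * y n" using B Suc by (intro add_mono mult_mono) (use y01 in auto)
    finally show ?case by (simp add: YS yS power2_eq_square)
  qed (simp add: Y0 y0)
  \<comment> \<open>The scalar increments dominate the operator increments; summed up, they transfer
    the Cauchy property from \<open>y\<close> to \<open>Y\<close>.\<close>
  have step: "norm (Y (Suc n) - Y n) \<le> y (Suc n) - y n" for n
  proof (induction n)
    case 0
    show ?case using B by (simp add: YS yS Y0 y0)
  next
    case (Suc n)
    define D where "D = Y (Suc n) - Y n"
    have "Y (Suc (Suc n)) - Y (Suc n) = (1/2) *\<^sub>R ((Y (Suc n) o\<^sub>L Y (Suc n)) - (Y n o\<^sub>L Y n))"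
      by (simp add: YS[of "Suc n"] YS[of n] scaleR_diff_right[symmetric] del: YS)
    \<comment> \<open>A difference of squares, factored without assuming that the two iterates
      commute.\<close>
    also have "\<dots> = (1/2) *\<^sub>R ((Y (Suc n) o\<^sub>L D) + (D o\<^sub>L Y n))"
      by (simp add: D_def bil)
    also have "norm \<dots> \<le> (1/2) * (norm (Y (Suc n)) * norm D + norm D * norm (Y n))"
      by (simp, rule order_trans[OF norm_triangle_ineq]) (intro add_mono norm_blinfun_compose)
    also have "\<dots> \<le> (1/2) * (y (Suc n) * (y (Suc n) - y n) + (y (Suc n) - y n) * y n)"
      using Suc Yy[of n] Yy[of "Suc n"] ymono[of n] y01[of n] y01[of "Suc n"]
      by (intro mult_left_mono add_mono mult_mono) (auto simp: D_def)
    also have "\<dots> = y (Suc (Suc n)) - y (Suc n)"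
    proof -
      have "2 * y (Suc (Suc n)) = 1 + y (Suc n) * y (Suc n)" "2 * y (Suc n) = 1 + y n * y n"
        by (simp_all add: yS power2_eq_square)
      then show ?thesis by (simp add: algebra_simps)
    qed
    finally show ?case .
  qed
  have tele: "norm (Y (n + k) - Y n) \<le> y (n + k) - y n" for n k
  proof (induction k)
    case (Suc k)
    have "norm (Y (n + Suc k) - Y n) \<le> norm (Y (Suc (n + k)) - Y (n + k)) + norm (Y (n + k) - Y n)"
      using norm_triangle_ineq[of "Y (Suc (n + k)) - Y (n + k)" "Y (n + k) - Y n"] by simp
    also have "\<dots> \<le> (y (Suc (n + k)) - y (n + k)) + (y (n + k) - y n)"
      using step Suc by (rule add_mono)
    finally show ?case by simp
  qed simp
  have "convergent y"
    using y01 ymono by (intro Bseq_mono_convergent BseqI'[of _ 1]) (auto intro: lift_Suc_mono_le)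
  then have "Cauchy y" by (rule convergent_Cauchy)
  have "Cauchy Y"
  proof (rule CauchyI')
    fix e :: real assume "e > 0"
    then obtain M where M: "\<And>m n. m \<ge> M \<Longrightarrow> n \<ge> M \<Longrightarrow> dist (y m) (y n) < e"
      using metric_CauchyD[OF \<open>Cauchy y\<close>] by blast
    have "dist (Y m) (Y n) < e" if "m \<ge> M" "n > m" for m n
      using tele[of m "n - m"] M[of n m] that by (simp add: dist_norm norm_minus_commute)
    then show "\<exists>M. \<forall>m\<ge>M. \<forall>n>m. dist (Y m) (Y n) < e" by blast
  qed
  then obtain Z where Z: "Y \<longlonglongrightarrow> Z" using Cauchy_convergent convergent_def by blast
  note lim = tendsto_intros bounded_bilinear.tendsto[OF bounded_bilinear_blinfun_compose]
  show ?thesis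
  proof (rule that[of Z])
    have "(\<lambda>n. norm (Y n)) \<longlonglongrightarrow> norm Z" by (intro lim Z)
    then show "norm Z \<le> 1"
      by (rule LIMSEQ_le_const2) (use Yy y01 order_trans in blast)
    have "(\<lambda>n. 2 *\<^sub>R Y (Suc n)) \<longlonglongrightarrow> 2 *\<^sub>R Z" by (intro lim LIMSEQ_Suc[OF Z])
    moreover have "(\<lambda>n. 2 *\<^sub>R Y (Suc n)) \<longlonglongrightarrow> B + (Z o\<^sub>L Z)"
      by (simp add: YS) (intro lim Z)
    ultimately show "2 *\<^sub>R Z = B + (Z o\<^sub>L Z)" by (rule LIMSEQ_unique)
    fix S assume S: "S o\<^sub>L B = B o\<^sub>L S"
    have "S o\<^sub>L Y n = Y n o\<^sub>L S" for n
    proof (induction n)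
      case (Suc n)
      have "S o\<^sub>L (Y n o\<^sub>L Y n) = (Y n o\<^sub>L Y n) o\<^sub>L S"
        using Suc by (metis (no_types, opaque_lifting) blinfun_apply_blinfun_compose blinfun_eqI)
      then show ?case by (simp add: YS bil S)
    qed (simp add: Y0)
    moreover have "(\<lambda>n. S o\<^sub>L Y n) \<longlonglongrightarrow> (S o\<^sub>L Z)" "(\<lambda>n. Y n o\<^sub>L S) \<longlonglongrightarrow> (Z o\<^sub>L S)"
      by (intro lim Z)+
    ultimately show "S o\<^sub>L Z = Z o\<^sub>L S" by (simp add: LIMSEQ_unique)
  qed
qed

text \<open>Take \<open>X\<close> as \<open>k\<close> times \<open>1 - Y\<close>, where
  \<open>Y\<close> is the root belonging to \<open>B\<close>, the operator 1 - T^2/k^2; then X^2 =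
  k^2 (1 - B) = T^2. What commutes with \<open>T\<close> commutes with \<open>B\<close>, hence with
  \<open>Y\<close>. The last clause is the one consequence of positivity of \<open>X\<close> that is
  used later.\<close>

lemma selfadjoint_absolute_value:
  fixes T :: "'a::{real_inner,banach} \<Rightarrow> 'a"
  assumes T: "bounded_linear T" and sym: "\<And>x y. inner (T x) y = inner x (T y)"
  obtains X where "bounded_linear X" "\<And>x. X (X x) = T (T x)"
    "\<And>S x. bounded_linear S \<Longrightarrow> (\<And>x. S (T x) = T (S x)) \<Longrightarrow> S (X x) = X (S x)"
    "\<And>v. inner (X v) v = 0 \<Longrightarrow> X v = 0"
proof -
  interpret T: bounded_linear T by (rule T)
  obtain k where k: "k > 0" and kT: "\<And>x. norm (T x) \<le> norm x * k"
    using T.pos_bounded by blast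
  \<comment> \<open>Dividing by the square of a norm bound \<open>k\<close> of \<open>T\<close>
    makes this a contraction, as expanding the norm of \<open>B0 x\<close> shows.\<close>
  define B0 where "B0 x = x - (1 / k\<^sup>2) *\<^sub>R T (T x)" for x
  have B0: "bounded_linear B0"
    unfolding B0_def
    by (intro bounded_linear_sub bounded_linear_ident bounded_linear_const_scaleR
        bounded_linear_compose[OF T T])
  define B where "B = Blinfun B0"
  have B: "blinfun_apply B x = B0 x" for x by (simp add: B_def bounded_linear_Blinfun_apply B0)
  have "norm (B0 x) \<le> norm x" for x
  proof -
    have "norm (T (T x)) \<le> norm (T x) * k" by (rule kT)
    then have "(norm (T (T x)))\<^sup>2 \<le> (norm (T x) * k)\<^sup>2" by (intro power_mono) auto
    then have TT: "inner (T (T x)) (T (T x)) \<le> k\<^sup>2 * inner (T x) (T x)"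
      by (simp add: power2_norm_eq_inner[symmetric] power_mult_distrib mult.commute)
    have "inner (B0 x) (B0 x) = inner x x - (2 / k\<^sup>2) * inner (T x) (T x)
        + (1 / k\<^sup>2) * ((1 / k\<^sup>2) * inner (T (T x)) (T (T x)))"
      by (simp add: B0_def inner_diff_left inner_diff_right sym[of "T x" x] sym[of x "T x", symmetric] inner_commute algebra_simps)
    also have "(1 / k\<^sup>2) * inner (T (T x)) (T (T x)) \<le> inner (T x) (T x)"
      using TT k by (simp add: divide_le_eq mult.commute)
    then have "inner x x - (2 / k\<^sup>2) * inner (T x) (T x)
        + (1 / k\<^sup>2) * ((1 / k\<^sup>2) * inner (T (T x)) (T (T x)))
        \<le> inner x x - (2 / k\<^sup>2) * inner (T x) (T x) + (1 / k\<^sup>2) * inner (T x) (T x)"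
      using k by (intro add_left_mono mult_left_mono) auto
    also have "\<dots> \<le> inner x x" using k by (simp add: field_simps)
    finally show ?thesis by (simp add: norm_eq_sqrt_inner)
  qed
  then have "norm B \<le> 1" by (intro norm_blinfun_bound) (auto simp: B)
  then obtain Y where Y: "norm Y \<le> 1" "2 *\<^sub>R Y = B + (Y o\<^sub>L Y)"
    and Ycomm: "\<And>S. S o\<^sub>L B = B o\<^sub>L S \<Longrightarrow> S o\<^sub>L Y = Y o\<^sub>L S"
    using contraction_quadratic_root[of B] by blast
  have Yn: "norm (blinfun_apply Y x) \<le> norm x" for x
    using norm_blinfun[of Y x] mult_right_mono[OF Y(1) norm_ge_zero, of x] by simp
  have YY: "blinfun_apply Y (blinfun_apply Y x) = 2 *\<^sub>R blinfun_apply Y x - B0 x" for x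
  proof -
    have "blinfun_apply (2 *\<^sub>R Y) x = blinfun_apply (B + (Y o\<^sub>L Y)) x" using Y(2) by simp
    then show ?thesis by (simp add: blinfun.bilinear_simps B)
  qed
  define X where "X x = k *\<^sub>R (x - blinfun_apply Y x)" for x
  show ?thesis
  proof (rule that[of X])
    show "bounded_linear X"
      unfolding X_def
      by (intro bounded_linear_const_scaleR bounded_linear_sub bounded_linear_ident
          blinfun.bounded_linear_right)
    show "X (X x) = T (T x)" for x
      using k by (simp add: X_def blinfun.bilinear_simps YY B0_def algebra_simps power2_eq_square
          scaleR_2)
    show "S (X x) = X (S x)" if S: "bounded_linear S" and c: "\<And>x. S (T x) = T (S x)" for S x
    proof -
      interpret S: bounded_linear S by (rule S)
      have "Blinfun S o\<^sub>L B = B o\<^sub>L Blinfun S"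
        by (intro blinfun_eqI)
          (simp add: B bounded_linear_Blinfun_apply S B0_def S.diff S.scaleR c)
      from Ycomm[OF this] have "blinfun_apply (Blinfun S o\<^sub>L Y) x = blinfun_apply (Y o\<^sub>L Blinfun S) x"
        by simp
      then show ?thesis by (simp add: X_def S.diff S.scaleR bounded_linear_Blinfun_apply S)
    qed
    show "X v = 0" if "inner (X v) v = 0" for v
    proof -
      define w where "w = blinfun_apply Y v"
      \<comment> \<open>This is the equality case of Cauchy-Schwarz: \<open>inner w v\<close> equals
        \<open>inner v v\<close> while \<open>w\<close> is no longer than \<open>v\<close>, so
        \<open>w = v\<close>.\<close>
      have "inner v v = inner w v" using that k by (simp add: X_def inner_diff_left w_def)
      moreover have "inner w w \<le> inner v v" using Yn[of v] by (simp add: w_def norm_eq_sqrt_inner)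
      ultimately have "inner (v - w) (v - w) \<le> 0"
        by (simp add: inner_diff_left inner_diff_right inner_commute)
      then have "v - w = 0" by (metis inner_eq_zero_iff inner_ge_zero order_antisym)
      then show ?thesis by (simp add: X_def w_def)
    qed
  qed
qed

section \<open>Complex Hilbert spaces through their real inner product\<close>

instance complex_hilbert_space \<subseteq> banach ..

text \<open>Reduces statements about complex scalars to real scalars and multiplication by the
  imaginary unit, so that the real Hilbert space lemmas apply.\<close>

lemma scaleC_Re_Im: "c *\<^sub>C x = Re c *\<^sub>R x + Im c *\<^sub>R (\<i> *\<^sub>C x)"
  for x :: "'a::complex_hilbert_space"
proof -
  have "c = complex_of_real (Re c) + complex_of_real (Im c) * \<i>" by (simp add: complex_eq_iff)
  then show ?thesis by (metis scaleC_add_left scaleR_scaleC scaleC_scaleC)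
qed

lemma scaleC_right_simps [simp]:
  fixes x :: "'a::complex_hilbert_space"
  shows "\<i> *\<^sub>C \<i> *\<^sub>C x = - x" "\<i> *\<^sub>C (- x) = - (\<i> *\<^sub>C x)" "c *\<^sub>C (0::'a) = 0"
  by (simp_all add: scaleC_scaleC)

lemma cinner_scaleC_right: "cinner x (c *\<^sub>C y) = cnj c * cinner x y"
  by (metis cinner_commute cinner_scaleC_left complex_cnj_mult)

lemma cinner_inner: "cinner x y = Complex (inner x y) (inner x (\<i> *\<^sub>C y))"
  by (simp add: inner_eq_Re_cinner cinner_scaleC_right complex_eq_iff)

lemma inner_i: "inner (\<i> *\<^sub>C x) y = - inner x (\<i> *\<^sub>C y)"
  by (simp add: inner_eq_Re_cinner cinner_scaleC_right cinner_scaleC_left)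

lemma norm_i [simp]: "norm (\<i> *\<^sub>C x) = norm x"
  by (simp add: norm_eq_sqrt_inner inner_i)

lemma bounded_linear_scaleC: "bounded_linear (\<lambda>x::'a::complex_hilbert_space. c *\<^sub>C x)"
proof -
  have i: "bounded_linear (\<lambda>x::'a. \<i> *\<^sub>C x)"
    by (rule bounded_linear_intro[of _ 1])
      (simp_all add: scaleC_add_right scaleR_scaleC scaleC_scaleC mult.commute)
  show ?thesis unfolding scaleC_Re_Im[of c]
    by (intro bounded_linear_add bounded_linear_const_scaleR bounded_linear_ident i)
qed

lemma complex_subspace_imp_subspace: "complex_vector.subspace V \<Longrightarrow> subspace V"
  by (simp add: complex_vector.subspace_def subspace_def scaleR_scaleC)

text \<open>Supplies the closed complex subspaces to which cyclicity is later applied.\<close>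

lemma closed_subspace_kernel:
  assumes "bounded_linear F" "\<And>c x. F (c *\<^sub>C x) = c *\<^sub>C F x"
  shows "complex_vector.subspace {x. F x = 0}" "closed {x. F x = 0}"
proof -
  interpret F: bounded_linear F by fact
  show "complex_vector.subspace {x. F x = 0}"
    by (simp add: complex_vector.subspace_def F.add assms(2))
  show "closed {x. F x = 0}"
    by (intro closed_Collect_eq continuous_intros F.continuous_on)
qed

text \<open>The real projection onto \<open>M\<close> is unique. As \<open>M\<close> is stable under
  complex scalars, uniqueness forces the projection to be complex linear.\<close>

lemma complex_orthogonal_projection:
  fixes M :: "'a::complex_hilbert_space set"
  assumes M: "complex_vector.subspace M" "closed M"
  shows "\<exists>P. bounded_linear P \<and> (\<forall>c x. P (c *\<^sub>C x) = c *\<^sub>C P x) \<and> (\<forall>x. P x \<in> M) \<and>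
    (\<forall>x\<in>M. P x = x) \<and> (\<forall>x y. inner (P x) y = inner x (P y))"
proof -
  have sub: "subspace M" using M(1) by (rule complex_subspace_imp_subspace)
  obtain P where PM: "\<And>x. P x \<in> M" and orth: "\<And>x y. y \<in> M \<Longrightarrow> inner (x - P x) y = 0"
    using orthogonal_projection_exists[OF sub M(2)] by metis
  have uniq: "P x = p" if "p \<in> M" "\<And>y. y \<in> M \<Longrightarrow> inner (x - p) y = 0" for x p
  proof -
    have "P x - p \<in> M" using that(1) PM sub by (simp add: subspace_diff)
    from that(2)[OF this] orth[OF this, of x] have "inner (P x - p) (P x - p) = 0"
      by (simp add: inner_diff_left)
    then show ?thesis by simp
  qed
  have add: "P (x + y) = P x + P y" for x y
    by (rule uniq) (use orth[of _ x] orth[of _ y] in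
      \<open>auto simp: PM sub subspace_add inner_diff_left inner_add_left\<close>)
  have scale: "P (c *\<^sub>C x) = c *\<^sub>C P x" for c x
  proof (rule uniq)
    show "c *\<^sub>C P x \<in> M" using M(1) PM by (simp add: complex_vector.subspace_scale)
    fix y assume "y \<in> M"
    \<comment> \<open>Orthogonality to both \<open>y\<close> and its multiple by the imaginary unit
      is orthogonality for the complex inner product.\<close>
    then have "\<i> *\<^sub>C y \<in> M" using M(1) by (simp add: complex_vector.subspace_scale)
    with orth[OF \<open>y \<in> M\<close>, of x] orth[OF this, of x] show "inner (c *\<^sub>C x - c *\<^sub>C P x) y = 0"
      by (simp add: scaleC_Re_Im[of c] inner_add_left inner_diff_left inner_i)
  qed
  have sym: "inner (P x) y = inner x (P y)" for x y
    using orth[OF PM, of x y] orth[OF PM, of y x]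
    by (simp add: inner_diff_left inner_diff_right inner_commute)
  have idem: "P x = x" if "x \<in> M" for x by (rule uniq) (use that in auto)
  have "norm (P x) \<le> norm x" for x
  proof (cases "P x = 0")
    case False
    have "norm (P x) * norm (P x) = inner x (P x)"
      using sym[of x "P x"] idem[OF PM] by (simp add: power2_norm_eq_inner[symmetric] power2_eq_square)
    also have "\<dots> \<le> norm x * norm (P x)" by (rule norm_cauchy_schwarz)
    finally show ?thesis using False by simp
  qed simp
  then have "bounded_linear P"
    by (intro bounded_linear_intro[of _ 1]) (simp_all add: add scale scaleR_scaleC)
  with PM scale sym idem show ?thesis by blast
qed

section \<open>Schur's lemma for compressed operators\<close>

text \<open>With $X = |T - c|$ we have $(T - c - X)(T - c + X) = 0$. As kernels are invariant, $T - c = \pm X$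
  on the range of $P$; choosing $c$ so that $T - c$ has a vanishing diagonal entry at some
  $v \neq 0$ puts $v$ into the kernel of $X$, hence of $T - c$.\<close>

lemma schur_compressed:
  fixes P T :: "'a::complex_hilbert_space \<Rightarrow> 'a" and R :: "('a \<Rightarrow> 'a) set"
  assumes cyclic: "\<And>V z. complex_vector.subspace V \<Longrightarrow> closed V \<Longrightarrow> z \<noteq> 0 \<Longrightarrow>
      (\<And>r. r \<in> R \<Longrightarrow> r z \<in> V) \<Longrightarrow> V = UNIV"
    and R: "\<And>r. r \<in> R \<Longrightarrow> bounded_linear r"
    and P: "bounded_linear P" "\<And>c x. P (c *\<^sub>C x) = c *\<^sub>C P x" "\<And>x. P (P x) = P x"
    and T: "bounded_linear T" "\<And>c x. T (c *\<^sub>C x) = c *\<^sub>C T x" "\<And>x y. inner (T x) y = inner x (T y)"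
    and TP: "\<And>x. T (P x) = P (T x)"
    and TR: "\<And>r x. r \<in> R \<Longrightarrow> T (P (r (P x))) = P (r (P (T x)))"
  shows "\<exists>c. \<forall>x. T (P x) = c *\<^sub>R P x"
proof (cases "\<forall>x. P x = 0")
  case False
  then obtain w where w: "P w \<noteq> 0" by blast
  define v where "v = P w"
  have v: "v \<noteq> 0" "P v = v" using w P(3) by (auto simp: v_def)
  \<comment> \<open>If \<open>F\<close> commutes with the compressions and kills \<open>z\<close>,
    then the kernel of \<open>F\<close> after \<open>P\<close> contains every \<open>r z\<close>
    with \<open>r\<close> in \<open>R\<close>. By cyclicity of \<open>z\<close> it is the whole
    space.\<close>
  have vanish: "F (P x) = 0"
    if F: "bounded_linear F" "\<And>c x. F (c *\<^sub>C x) = c *\<^sub>C F x"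
      and FR: "\<And>r x. r \<in> R \<Longrightarrow> F (P (r (P x))) = P (r (P (F x)))"
      and z: "z \<noteq> 0" "P z = z" "F z = 0" for F z x
  proof -
    have "bounded_linear (\<lambda>x. F (P x))" using F(1) P(1) by (rule bounded_linear_compose)
    note V = closed_subspace_kernel[OF this]
    have "r z \<in> {x. F (P x) = 0}" if "r \<in> R" for r
      using FR[OF that, of z] z R[OF that] P(1) by (simp add: linear_simps)
    then have "{x. F (P x) = 0} = UNIV"
      by (intro cyclic[OF V z(1)]) (auto simp: F P)
    then show ?thesis by blast
  qed
  \<comment> \<open>The Rayleigh quotient of \<open>T\<close> at \<open>v\<close>, the only possible
    value of the scalar; it makes \<open>S v\<close> orthogonal to \<open>v\<close>.\<close>
  define c where "c = inner (T v) v / inner v v"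
  define S where "S x = T x - c *\<^sub>R x" for x
  have S: "bounded_linear S" unfolding S_def
    by (intro bounded_linear_sub bounded_linear_const_scaleR bounded_linear_ident T(1))
  have S_comm: "U (S x) = S (U x)" if "bounded_linear U" "\<And>x. U (T x) = T (U x)" for U x
    using that by (simp add: S_def linear_simps)
  have S_sym: "inner (S x) y = inner x (S y)" for x y
    by (simp add: S_def inner_diff_left inner_diff_right T(3))
  obtain X where X: "bounded_linear X" "\<And>x. X (X x) = S (S x)"
      "\<And>U x. bounded_linear U \<Longrightarrow> (\<And>x. U (S x) = S (U x)) \<Longrightarrow> U (X x) = X (U x)"
      "\<And>v. inner (X v) v = 0 \<Longrightarrow> X v = 0"
    using selfadjoint_absolute_value[OF S S_sym] by blast
  have X_comm: "U (X x) = X (U x)" if "bounded_linear U" "\<And>x. U (T x) = T (U x)" for U x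
    by (rule X(3)[OF that(1) S_comm[OF that]])
  have A: "bounded_linear (\<lambda>x. P (r (P x)))" if "r \<in> R" for r
    by (intro bounded_linear_compose[OF P(1)] bounded_linear_compose[OF R[OF that]] P(1))
  have SC: "S (a *\<^sub>C x) = a *\<^sub>C S x" and XC: "X (a *\<^sub>C x) = a *\<^sub>C X x" for a x
    using S_comm[OF bounded_linear_scaleC[of a]] X_comm[OF bounded_linear_scaleC[of a]] T(2) by auto
  have SP: "S (P x) = P (S x)" and XP: "X (P x) = P (X x)" for x
    using S_comm[OF P(1)] X_comm[OF P(1)] TP by auto
  have SR: "S (P (r (P x))) = P (r (P (S x)))" and XR: "X (P (r (P x))) = P (r (P (X x)))"
    if "r \<in> R" for r x
    using S_comm[OF A[OF that]] X_comm[OF A[OF that]] TR[OF that] by auto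
  have SX: "S (X x) = X (S x)" for x by (rule X(3)[OF S]) simp
  note lin = linear_simps[OF S] linear_simps[OF X(1)] linear_simps[OF P(1)]
  have rlin: "r (x + y) = r x + r y" "r (x - y) = r x - r y" if "r \<in> R" for r x y
    using linear_simps[OF R[OF that]] by auto
  \<comment> \<open>\<open>S\<close> and \<open>X\<close> commute and have equal squares, so
    \<open>S - X\<close> kills the range of \<open>S + X\<close>. Either \<open>S + X\<close>
    vanishes on the range of \<open>P\<close>, or \<open>vanish\<close> applies to
    \<open>S - X\<close> at a nonzero vector of that range.\<close>
  have "\<exists>s. \<forall>x. S (P x) = s *\<^sub>R X (P x)"
  proof (cases "\<forall>x. S (P x) + X (P x) = 0")
    case True
    then show ?thesis by (intro exI[of _ "-1"]) (simp add: eq_neg_iff_add_eq_0)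
  next
    case False
    then obtain y where y: "S (P y) + X (P y) \<noteq> 0" by blast
    have "S (P x) - X (P x) = 0" for x
    proof (rule vanish[of "\<lambda>x. S x - X x" "S (P y) + X (P y)"])
      show "bounded_linear (\<lambda>x. S x - X x)" by (intro bounded_linear_sub S X(1))
      show "S (a *\<^sub>C x) - X (a *\<^sub>C x) = a *\<^sub>C (S x - X x)" for a x
        by (simp add: SC XC complex_vector.scale_right_diff_distrib)
      show "S (P (r (P x))) - X (P (r (P x))) = P (r (P (S x - X x)))" if "r \<in> R" for r x
        using that by (simp add: SR XR lin rlin)
      show "P (S (P y) + X (P y)) = S (P y) + X (P y)"
        by (simp add: lin SP XP P(3))
      show "S (S (P y) + X (P y)) - X (S (P y) + X (P y)) = 0"
        by (simp add: lin SX X(2))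
    qed (use y in simp)
    then show ?thesis by (intro exI[of _ 1]) simp
  qed
  then obtain s where s: "\<And>x. S (P x) = s *\<^sub>R X (P x)" by blast
  \<comment> \<open>Since \<open>S v\<close> is \<open>s\<close> times \<open>X v\<close>, either
    \<open>s = 0\<close> or the last property of \<open>X\<close> gives
    \<open>X v = 0\<close>.\<close>
  have "inner (S v) v = 0" using v by (simp add: S_def c_def inner_diff_left)
  then have "s = 0 \<or> inner (X v) v = 0" using s[of v] v by simp
  then have "S v = 0" using s[of v] v X(4)[of v] by auto
  have "S (P x) = 0" for x
    using vanish[OF S SC SR v \<open>S v = 0\<close>] .
  then show ?thesis by (intro exI[of _ c]) (simp add: S_def)
qed (auto simp: linear_simps[OF T(1)])

section \<open>Finite partial injections and disjoint supports\<close>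

text \<open>The points of \<open>f\<close>
  A\<open>outside\<close>A\<open>are as many as those of\<close>A\<open>outside\<close>f
  \<open>A\<close>; any bijection between these two sets completes \<open>f\<close> to a permutation
  of the union.\<close>

lemma extend_inj_on_permutes:
  assumes "finite A" "inj_on f A" "A \<subseteq> S" "f ` A \<subseteq> S"
  obtains a where "a permutes S" "\<And>x. x \<in> A \<Longrightarrow> a x = f x"
proof -
  let ?U = "A \<union> f ` A"
  have "card (?U - A) = card (?U - f ` A)"
    using assms(1,2) by (simp add: card_Diff_subset card_image)
  then obtain g where g: "bij_betw g (?U - A) (?U - f ` A)"
    using finite_same_card_bij[of "?U - A" "?U - f ` A"] assms(1) by auto
  define a where "a x = (if x \<in> A then f x else if x \<in> ?U then g x else x)" for x
  have "bij_betw a A (f ` A)"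
    using assms(2) by (simp add: bij_betw_def inj_on_def a_def)
  moreover have "bij_betw a (?U - A) (?U - f ` A)"
    using g by (subst bij_betw_cong[of _ _ g]) (auto simp: a_def)
  ultimately have "bij_betw a (A \<union> (?U - A)) (f ` A \<union> (?U - f ` A))"
    by (rule bij_betw_combine) auto
  moreover have "A \<union> (?U - A) = ?U" "f ` A \<union> (?U - f ` A) = ?U" by auto
  ultimately have "a permutes ?U"
    by (intro bij_imp_permutes) (auto simp: a_def)
  then have "a permutes S" by (rule permutes_subset) (use assms in auto)
  moreover have "a x = f x" if "x \<in> A" for x using that by (simp add: a_def)
  ultimately show ?thesis by (rule that)
qed

lemma permutes_disjoint_commute:
  assumes "p permutes A" "q permutes B" "A \<inter> B = {}"
  shows "p \<circ> q = q \<circ> p"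
proof
  fix x
  show "(p \<circ> q) x = (q \<circ> p) x"
  proof (cases "x \<in> A")
    case True
    then have "x \<notin> B" "p x \<notin> B" using permutes_in_image[OF assms(1), of x] assms(3) by blast+
    then show ?thesis using permutes_not_in[OF assms(2)] by simp
  next
    case False
    have "q x \<notin> A"
      using permutes_in_image[OF assms(2), of x] permutes_not_in[OF assms(2), of x] assms(3) False
      by (cases "x \<in> B") auto
    with False show ?thesis using permutes_not_in[OF assms(1)] by simp
  qed
qed

lemma permutes_conj:
  assumes "t permutes S" "p permutes A" "A \<subseteq> S"
  shows "t \<circ> p \<circ> Hilbert_Choice.inv t permutes t ` A"
proof (rule permutes_superset)
  show "t \<circ> p \<circ> Hilbert_Choice.inv t permutes S"
    using assms by (blast intro: permutes_compose permutes_inv permutes_subset)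
  fix x assume "x \<in> S - t ` A"
  moreover have "x = t (Hilbert_Choice.inv t x)" by (simp only: permutes_inverses(1)[OF assms(1)])
  ultimately have "Hilbert_Choice.inv t x \<notin> A" by blast
  then show "(t \<circ> p \<circ> Hilbert_Choice.inv t) x = x"
    using permutes_inverses(1)[OF assms(1)] permutes_not_in[OF assms(2)] by simp
qed

text \<open>Transitivity of the infinite symmetric group on pairs of embeddings of a finite block
  with disjoint images. It is what makes matrix coefficients of far apart translates independent of
  the translates.\<close>

lemma pair_of_partial_permutations_conjugate:
  fixes p q p' q' :: "nat \<Rightarrow> nat"
  assumes perm: "p permutes {1..}" "q permutes {1..}" "p' permutes {1..}" "q' permutes {1..}"
    and disj: "p ` {1..m} \<inter> q ` {1..m} = {}" "p' ` {1..m} \<inter> q' ` {1..m} = {}"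
  obtains a where "a permutes {1..}"
    "\<And>x. x \<in> {1..m} \<Longrightarrow> a (p x) = p' x" "\<And>x. x \<in> {1..m} \<Longrightarrow> a (q x) = q' x"
proof -
  define I where "I = {1..m}"
  \<comment> \<open>The required partial map, glued from its values on the two images; disjointness
    makes it well defined and injective.\<close>
  define f where "f y = (if y \<in> p ` I then p' (Hilbert_Choice.inv p y) else q' (Hilbert_Choice.inv q y))" for y
  note disj = disj[folded I_def]
  have fp: "f (p x) = p' x" if "x \<in> I" for x
    using that permutes_inverses(2)[OF perm(1)] by (simp add: f_def)
  have fq: "f (q x) = q' x" if "x \<in> I" for x
  proof -
    have "q x \<notin> p ` I" using disj(1) that by blast
    then show ?thesis using permutes_inverses(2)[OF perm(2)] by (simp add: f_def)
  qed
  have im: "f ` p ` I = p' ` I" "f ` q ` I = q' ` I"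
    by (simp_all add: image_image fp fq cong: image_cong_simp)
  have "inj_on f (p ` I)" "inj_on f (q ` I)"
    using inj_on_subset[OF permutes_inj[OF perm(3)]] inj_on_subset[OF permutes_inj[OF perm(4)]]
    by (auto intro!: inj_on_imageI simp: fp fq cong: inj_on_cong)
  moreover have "f ` (p ` I - q ` I) \<inter> f ` (q ` I - p ` I) = {}"
    using disj(2) im by blast
  ultimately have inj: "inj_on f (p ` I \<union> q ` I)" by (simp add: inj_on_Un)
  have I: "I \<subseteq> {1..}" by (auto simp: I_def)
  then have sub: "r ` I \<subseteq> {1..}" if "r permutes {1..}" for r
    using permutes_image[OF that] by blast
  have "finite (p ` I \<union> q ` I)" by (simp add: I_def)
  then obtain a where "a permutes {1..}" "\<And>y. y \<in> p ` I \<union> q ` I \<Longrightarrow> a y = f y"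
    by (rule extend_inj_on_permutes[OF _ inj, of "{1..}"])
      (simp_all only: image_Un im Un_subset_iff sub perm simp_thms)
  then show ?thesis using fp fq by (intro that[of a]) (auto simp: I_def)
qed

section \<open>Unitary representations of the \<open>n\<close>-symmetric group\<close>

abbreviation diag :: "nat \<Rightarrow> (nat \<Rightarrow> nat) \<Rightarrow> nat \<Rightarrow> nat \<Rightarrow> nat"
  where "diag n p \<equiv> \<lambda>i\<in>{1..n}. p"

text \<open>This is the finite subgroup of \<open>n\<close>-tuples from the symmetric group on
  \<open>m\<close> letters.\<close>

definition supported_tuples :: "nat \<Rightarrow> nat \<Rightarrow> (nat \<Rightarrow> nat \<Rightarrow> nat) set"
  where "supported_tuples n m = {f \<in> carrier (nsym n). \<forall>i\<in>{1..n}. f i permutes {1..m}}"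

lemma diag_in_nsym: "p permutes {1..} \<Longrightarrow> diag n p \<in> carrier (nsym n)"
  using subgroup.subset[OF subgroup_diag_stab, of n 0] by (auto simp: diag_stab_0)

lemma supported_tuples_mono: "m \<le> m' \<Longrightarrow> supported_tuples n m \<subseteq> supported_tuples n m'"
  by (auto simp: supported_tuples_def intro: permutes_subset)

lemma supported_tuples_inv:
  assumes f: "f \<in> supported_tuples n m"
  shows "inv\<^bsub>nsym n\<^esub> f \<in> supported_tuples n m"
proof -
  interpret group "nsym n" by (rule group_nsym)
  have fc: "f \<in> carrier (nsym n)" using f by (simp add: supported_tuples_def)
  have "(inv\<^bsub>nsym n\<^esub> f) i permutes {1..m}" if i: "i \<in> {1..n}" for i
  proof -
    have "(inv\<^bsub>nsym n\<^esub> f \<otimes>\<^bsub>nsym n\<^esub> f) i = id" "(f \<otimes>\<^bsub>nsym n\<^esub> inv\<^bsub>nsym n\<^esub> f) i = id"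
      using l_inv[OF fc] r_inv[OF fc] i by (simp_all only: nsym_simps restrict_apply if_True)
    then have "(inv\<^bsub>nsym n\<^esub> f) i \<circ> f i = id" "f i \<circ> (inv\<^bsub>nsym n\<^esub> f) i = id"
      using i by simp_all
    then have "(inv\<^bsub>nsym n\<^esub> f) i = Hilbert_Choice.inv (f i)"
      by (metis inv_unique_comp)
    then show ?thesis using f i by (simp add: supported_tuples_def permutes_inv)
  qed
  then show ?thesis using fc by (simp add: supported_tuples_def)
qed

text \<open>Dividing all entries by the first one leaves finitely supported permutations, by the
  definition of the group. There are finitely many entries, so one \<open>m\<close> bounds all
  supports.\<close>

lemma nsym_decompose:
  assumes n: "n \<ge> 1" and g: "g \<in> carrier (nsym n)"
  obtains m f p where "f \<in> supported_tuples n m" "p permutes {1..}" "g = f \<otimes>\<^bsub>nsym n\<^esub> diag n p"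
proof -
  interpret group "nsym n" by (rule group_nsym)
  define p where "p = g 1"
  define f where "f = g \<otimes>\<^bsub>nsym n\<^esub> diag n (Hilbert_Choice.inv p)"
  have p: "p permutes {1..}" using g n by (auto simp: p_def carrier_nsym PiE_iff)
  have f: "f \<in> carrier (nsym n)"
    unfolding f_def using g p by (intro m_closed diag_in_nsym permutes_inv)
  have fi: "f i = g i \<circ> Hilbert_Choice.inv p" if "i \<in> {1..n}" for i
    using that by (simp add: f_def)
  have fin: "f i \<in> S_inf_fin" if "i \<in> {1..n}" for i
    using g n that unfolding fi[OF that] p_def carrier_nsym by auto
  then have "finite (\<Union>i\<in>{1..n}. {x. f i x \<noteq> x})" by (simp add: S_inf_fin_def)
  then obtain m where m: "\<And>x. x \<in> (\<Union>i\<in>{1..n}. {x. f i x \<noteq> x}) \<Longrightarrow> x \<le> m"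
    by (meson finite_nat_set_iff_bounded_le)
  have "f i permutes {1..m}" if i: "i \<in> {1..n}" for i
  proof (rule permutes_superset)
    show "f i permutes {1..}" using fin[OF i] by (simp add: S_inf_fin_def)
    show "f i x = x" if "x \<in> {1..} - {1..m}" for x using m[of x] that i by force
  qed
  with f have "f \<in> supported_tuples n m" by (simp add: supported_tuples_def)
  moreover have "g = f \<otimes>\<^bsub>nsym n\<^esub> diag n p"
  proof
    fix i
    have "g i = undefined" if "i \<notin> {1..n}" using g that by (auto simp: carrier_nsym PiE_iff extensional_def)
    then show "g i = (f \<otimes>\<^bsub>nsym n\<^esub> diag n p) i"
      using p by (auto simp: fi comp_assoc permutes_inv_o)
  qed
  ultimately show ?thesis using p that by blast
qed

section \<open>The action of the diagonal subgroup\<close>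

locale nsym_unitary =
  fixes n :: nat and \<rho> :: "(nat \<Rightarrow> nat \<Rightarrow> nat) \<Rightarrow> 'a \<Rightarrow> 'a::complex_hilbert_space"
  assumes n_pos: "n \<ge> 1" and hom: "\<rho> \<in> hom (nsym n) unitary_group"
begin

sublocale group "nsym n" by (rule group_nsym)

definition D where "D p = \<rho> (diag n p)"

definition H0 where "H0 = {v. \<forall>p. p permutes {1..} \<longrightarrow> D p v = v}"

text \<open>These are the vectors fixed by K(m): the permutations of \<open>{m<..}\<close> are those
  of \<open>{1..}\<close> that fix 1, ..., m.\<close>

definition stab_fixed where "stab_fixed m = {x. \<forall>p. p permutes {m<..} \<longrightarrow> D p x = x}"

lemma
  assumes g: "g \<in> carrier (nsym n)"
  shows rho_add: "\<rho> g (x + y) = \<rho> g x + \<rho> g y"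
    and rho_scaleC: "\<rho> g (c *\<^sub>C x) = c *\<^sub>C \<rho> g x"
    and rho_inner: "inner (\<rho> g x) (\<rho> g y) = inner x y"
proof -
  have *: "Vector_Spaces.linear scaleC scaleC (\<rho> g)" "\<And>x y. cinner (\<rho> g x) (\<rho> g y) = cinner x y"
    using hom g by (auto simp: hom_def unitary_group_def)
  then show "\<rho> g (x + y) = \<rho> g x + \<rho> g y" "\<rho> g (c *\<^sub>C x) = c *\<^sub>C \<rho> g x"
    by (auto simp: Vector_Spaces.linear_iff)
  show "inner (\<rho> g x) (\<rho> g y) = inner x y" by (simp add: inner_eq_Re_cinner *)
qed

lemma rho_bounded_linear: "g \<in> carrier (nsym n) \<Longrightarrow> bounded_linear (\<rho> g)"
  by (rule bounded_linear_intro[of _ 1])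
    (simp_all add: rho_add rho_scaleC scaleR_scaleC norm_eq_sqrt_inner rho_inner)

lemma rho_mult:
  "g \<in> carrier (nsym n) \<Longrightarrow> h \<in> carrier (nsym n) \<Longrightarrow> \<rho> (g \<otimes>\<^bsub>nsym n\<^esub> h) x = \<rho> g (\<rho> h x)"
  using hom by (auto simp: hom_def unitary_group_def simp del: nsym_simps)

text \<open>A homomorphism sends the unit to an idempotent, and an idempotent isometry is the
  identity.\<close>

lemma rho_one: "\<rho> \<one>\<^bsub>nsym n\<^esub> x = x"
proof -
  have "\<rho> \<one>\<^bsub>nsym n\<^esub> (\<rho> \<one>\<^bsub>nsym n\<^esub> x - x) = 0"
    using rho_mult[of "\<one>\<^bsub>nsym n\<^esub>" "\<one>\<^bsub>nsym n\<^esub>" x] linear_simps(2)[OF rho_bounded_linear[OF one_closed]]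
    by (simp del: nsym_simps)
  then have "inner (\<rho> \<one>\<^bsub>nsym n\<^esub> x - x) (\<rho> \<one>\<^bsub>nsym n\<^esub> x - x) = 0"
    using rho_inner[OF one_closed] by (metis inner_zero_left)
  then show ?thesis by simp
qed

lemma rho_adjoint:
  assumes "g \<in> carrier (nsym n)"
  shows "inner (\<rho> g x) y = inner x (\<rho> (inv\<^bsub>nsym n\<^esub> g) y)"
  using rho_inner[OF assms, of x "\<rho> (inv\<^bsub>nsym n\<^esub> g) y"]
  by (simp add: rho_mult[OF assms inv_closed[OF assms], symmetric] r_inv[OF assms] rho_one del: nsym_simps)

lemma D_comp:
  assumes "p permutes {1..}" "q permutes {1..}"
  shows "D (p \<circ> q) x = D p (D q x)"
proof -
  have "diag n (p \<circ> q) = diag n p \<otimes>\<^bsub>nsym n\<^esub> diag n q" by auto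
  then show ?thesis unfolding D_def using assms by (simp only: rho_mult diag_in_nsym)
qed

lemma D_id: "D id x = x"
  using rho_one by (simp add: D_def)

lemma D_inner: "p permutes {1..} \<Longrightarrow> inner (D p x) (D p y) = inner x y"
  unfolding D_def by (intro rho_inner diag_in_nsym)

lemma D_inv:
  assumes "p permutes {1..}"
  shows "D p (D (Hilbert_Choice.inv p) x) = x" "D (Hilbert_Choice.inv p) (D p x) = x"
  by (simp_all add: D_comp[OF assms permutes_inv[OF assms], symmetric]
      D_comp[OF permutes_inv[OF assms] assms, symmetric] permutes_inv_o[OF assms] D_id)

lemma D_adjoint:
  assumes "p permutes {1..}"
  shows "inner (D p x) y = inner x (D (Hilbert_Choice.inv p) y)"
  using D_inner[OF assms, of x "D (Hilbert_Choice.inv p) y"] by (simp only: D_inv[OF assms])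

text \<open>The quotient of \<open>p\<close> and \<open>q\<close> fixes 1, ..., m pointwise, so it
  acts trivially on \<open>x\<close>.\<close>

lemma D_cong:
  assumes x: "x \<in> stab_fixed m" and p: "p permutes {1..}" and q: "q permutes {1..}"
    and eq: "\<And>i. i \<in> {1..m} \<Longrightarrow> p i = q i"
  shows "D p x = D q x"
proof -
  let ?r = "Hilbert_Choice.inv q \<circ> p"
  have r: "?r permutes {1..}" using p q by (intro permutes_compose permutes_inv)
  have "?r permutes {m<..}"
  proof (rule permutes_superset[OF r])
    show "?r y = y" if "y \<in> {1..} - {m<..}" for y
      using eq[of y] that q by (simp add: permutes_inverses)
  qed
  then have "D ?r x = x" using x by (simp add: stab_fixed_def)
  then show ?thesis using D_comp[OF permutes_inv[OF q] p] D_inv(1)[OF q] by metis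
qed

text \<open>One permutation \<open>a\<close> carries both blocks to their new places, and
  \<open>D a\<close> preserves inner products.\<close>

lemma inner_D_disjoint:
  assumes x: "x \<in> stab_fixed m" and y: "y \<in> stab_fixed m"
    and perm: "p permutes {1..}" "q permutes {1..}" "p' permutes {1..}" "q' permutes {1..}"
    and disj: "p ` {1..m} \<inter> q ` {1..m} = {}" "p' ` {1..m} \<inter> q' ` {1..m} = {}"
  shows "inner (D p x) (D q y) = inner (D p' x) (D q' y)"
proof -
  obtain a where a: "a permutes {1..}" "\<And>i. i \<in> {1..m} \<Longrightarrow> a (p i) = p' i"
      "\<And>i. i \<in> {1..m} \<Longrightarrow> a (q i) = q' i"
    using pair_of_partial_permutations_conjugate[OF perm disj] by blast
  have "inner (D p x) (D q y) = inner (D (a \<circ> p) x) (D (a \<circ> q) y)"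
    using perm a(1) by (simp only: D_comp D_inner)
  moreover have "D (a \<circ> p) x = D p' x" "D (a \<circ> q) y = D q' y"
    using D_cong[OF x permutes_compose[OF perm(1) a(1)] perm(3)]
      D_cong[OF y permutes_compose[OF perm(2) a(1)] perm(4)] a by auto
  ultimately show ?thesis by simp
qed

lemma D_bounded_linear: "p permutes {1..} \<Longrightarrow> bounded_linear (D p)"
  unfolding D_def by (intro rho_bounded_linear diag_in_nsym)

lemma complex_subspace_H0: "complex_vector.subspace H0"
  by (auto simp: complex_vector.subspace_def H0_def D_def rho_add rho_scaleC diag_in_nsym
      simp del: One_nat_def)
    (metis D_bounded_linear D_def linear_simps(3))

lemma closed_H0: "closed H0"
proof -
  have "closed {v. D p v = v}" if "p permutes {1..}" for p
    using bounded_linear.continuous_on[OF D_bounded_linear[OF that] continuous_on_id]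
    by (intro closed_Collect_eq) auto
  moreover have "H0 = (\<Inter>p\<in>{p. p permutes {1..}}. {v. D p v = v})" by (auto simp: H0_def)
  ultimately show ?thesis by (simp only:) (intro closed_INT ballI, simp del: One_nat_def)
qed

section \<open>The projection onto the K-fixed vectors\<close>

definition proj :: "'a \<Rightarrow> 'a" where
  "proj = (SOME P. bounded_linear P \<and> (\<forall>c x. P (c *\<^sub>C x) = c *\<^sub>C P x) \<and> (\<forall>x. P x \<in> H0) \<and>
    (\<forall>x\<in>H0. P x = x) \<and> (\<forall>x y. inner (P x) y = inner x (P y)))"

lemma
  shows proj_bounded_linear: "bounded_linear proj"
    and proj_scaleC: "proj (c *\<^sub>C x) = c *\<^sub>C proj x"
    and proj_in_H0: "proj x \<in> H0"
    and proj_H0: "x \<in> H0 \<Longrightarrow> proj x = x"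
    and proj_adjoint: "inner (proj x) y = inner x (proj y)"
  using someI_ex[OF complex_orthogonal_projection[OF complex_subspace_H0 closed_H0]]
  unfolding proj_def[symmetric] by blast+

lemma proj_proj: "proj (proj x) = proj x"
  by (rule proj_H0[OF proj_in_H0])

text \<open>Translates of \<open>x\<close> along pairwise disjoint blocks are equiangular, hence
  have a limit \<open>u\<close> of averages. It is K-fixed and pairs with \<open>H0\<close> as
  \<open>x\<close> does, so it is \<open>proj x\<close>; its pairing with \<open>y\<close> is the
  common value for disjoint blocks.\<close>

lemma inner_proj_disjoint:
  assumes x: "x \<in> stab_fixed m" and y: "y \<in> stab_fixed m"
    and perm: "p permutes {1..}" "q permutes {1..}"
    and disj: "p ` {1..m} \<inter> q ` {1..m} = {}"
  shows "inner (proj x) y = inner (D p x) (D q y)"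
proof -
  \<comment> \<open>\<open>t j\<close> shifts the block 1, ..., m by \<open>j * m\<close>, so
    distinct \<open>j\<close> give disjoint images that leave every finite set.\<close>
  have "\<exists>t. t permutes {1..} \<and> (\<forall>i\<in>{1..m}. t i = i + j * m)" for j
    by (rule extend_inj_on_permutes[of "{1..m}" "\<lambda>i. i + j * m" "{1..}"]) (auto simp: inj_on_def)
  then obtain t where t: "\<And>j. t j permutes {1..}"
    and t_eq: "\<And>j i. i \<in> {1..m} \<Longrightarrow> t j i = i + j * m" by metis
  have t_disj: "t i ` {1..m} \<inter> t j ` {1..m} = {}" if "i \<noteq> j" for i j
  proof -
    have "a + i * m \<noteq> b + j * m" if "i < j" "a \<in> {1..m}" "b \<in> {1..m}" for a b i j
    proof -
      have "Suc i * m \<le> j * m" using that by (intro mult_le_mono1) simp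
      then show ?thesis using that by simp
    qed
    then have "t i a \<noteq> t j b" if "a \<in> {1..m}" "b \<in> {1..m}" for a b
      using that \<open>i \<noteq> j\<close> unfolding t_eq[OF that(1)] t_eq[OF that(2)] by (metis nat_neq_iff)
    then show ?thesis by blast
  qed
  have t_away: "\<forall>\<^sub>F j in sequentially. t j ` {1..m} \<inter> r ` {1..m} = {}" for r
  proof -
    obtain b where b: "\<And>z. z \<in> r ` {1..m} \<Longrightarrow> z \<le> b"
      using finite_nat_set_iff_bounded_le[of "r ` {1..m}"] by auto
    have "t j ` {1..m} \<inter> r ` {1..m} = {}" if "j \<ge> b" for j
    proof -
      have "b < t j i" if "i \<in> {1..m}" for i
      proof -
        have "j \<le> j * m" "0 < i" using that by auto
        then show ?thesis using \<open>j \<ge> b\<close> unfolding t_eq[OF that] by linarith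
      qed
      moreover have "r i \<le> b" if "i \<in> {1..m}" for i using b[OF imageI[OF that]] .
      ultimately have "t j i \<noteq> r k" if "i \<in> {1..m}" "k \<in> {1..m}" for i k
        using that by (metis leD)
      then show ?thesis by blast
    qed
    then show ?thesis by (rule eventually_sequentiallyI)
  qed
  define c where "c = inner (D (t 0) x) (D (t 1) x)"
  have c: "inner (D p' x) (D q' x) = c"
    if "p' permutes {1..}" "q' permutes {1..}" "p' ` {1..m} \<inter> q' ` {1..m} = {}" for p' q'
    unfolding c_def by (rule inner_D_disjoint[OF x x that(1,2) t t that(3) t_disj]) simp
  have "inner (D (t i) x) (D (t j) x) = (if i = j then inner x x else c)" for i j
    using c[OF t t t_disj] D_inner[OF t] by simp
  then obtain u where u: "\<And>y a. \<forall>\<^sub>F j in sequentially. inner (D (t j) x) y = a \<Longrightarrow> inner u y = a"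
    by (rule equiangular_weak_limit[of "\<lambda>j. D (t j) x"]) blast
  \<comment> \<open>For fixed \<open>i\<close> and \<open>r\<close>, the image of the block under
    \<open>t j\<close> eventually avoids its image under \<open>r \<circ> t i\<close>.\<close>
  have u_D: "inner u (D r (D (t i) x)) = c" if r: "r permutes {1..}" for r i
  proof (rule u)
    have rt: "r \<circ> t i permutes {1..}" using t r by (rule permutes_compose)
    show "\<forall>\<^sub>F j in sequentially. inner (D (t j) x) (D r (D (t i) x)) = c"
      using t_away[of "r \<circ> t i"]
      by eventually_elim (simp only: D_comp[OF r t, symmetric] c[OF t rt])
  qed
  have u_Du: "inner u (D r u) = c" if r: "r permutes {1..}" for r
  proof (rule u)
    have "inner (D (t j) x) (D r u) = c" for j
      using u_D[OF permutes_inv[OF r], of j] D_adjoint[OF permutes_inv[OF r], of "D (t j) x" u]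
      by (simp add: permutes_inv_inv[OF r] inner_commute)
    then show "\<forall>\<^sub>F j in sequentially. inner (D (t j) x) (D r u) = c" by simp
  qed
  \<comment> \<open>\<open>u\<close> and \<open>D r u\<close> have the same norm, and their inner
    product equals its square, so they coincide.\<close>
  have "D r u = u" if r: "r permutes {1..}" for r
  proof -
    have "inner u u = c" using u_Du[OF permutes_id] by (simp only: D_id)
    then have "inner (D r u - u) (D r u - u) = 0"
      using D_inner[OF r, of u u] u_Du[OF r]
      by (simp add: inner_diff_left inner_diff_right inner_commute)
    then show ?thesis by simp
  qed
  then have uH: "u \<in> H0" by (simp add: H0_def)
  \<comment> \<open>Here the pairings are constant in \<open>j\<close>, because
    \<open>D (t j)\<close> fixes \<open>w\<close>.\<close>
  have "inner u w = inner (proj x) w" if w: "w \<in> H0" for w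
  proof (rule u)
    have "inner (D (t j) x) w = inner (proj x) w" for j
    proof -
      have "inner (D (t j) x) w = inner (D (t j) x) (D (t j) w)"
        using w t by (simp add: H0_def)
      also have "\<dots> = inner (proj x) w" using w by (simp only: D_inner[OF t] proj_adjoint proj_H0)
      finally show ?thesis .
    qed
    then show "\<forall>\<^sub>F j in sequentially. inner (D (t j) x) w = inner (proj x) w" by simp
  qed
  from this[of "u - proj x"] have "inner (u - proj x) (u - proj x) = 0"
    using complex_vector.subspace_diff[OF complex_subspace_H0 uH proj_in_H0]
    by (simp add: inner_diff_left)
  then have "u = proj x" by simp
  moreover have "inner u y = inner (D p x) (D q y)"
  proof (rule u)
    show "\<forall>\<^sub>F j in sequentially. inner (D (t j) x) y = inner (D p x) (D q y)"
      using t_away[of id]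
    proof eventually_elim
      case (elim j)
      show ?case using inner_D_disjoint[OF x y t permutes_id perm elim disj] by (simp only: D_id)
    qed
  qed
  ultimately show ?thesis by simp
qed

text \<open>Diagonal permutations that fix 1, ..., m commute with \<open>f\<close>, so they can be
  moved past \<open>\<rho> f\<close> onto the K-fixed vector \<open>v\<close>.\<close>

lemma supported_stab_fixed:
  assumes f: "f \<in> supported_tuples n m" and v: "v \<in> H0"
  shows "\<rho> f v \<in> stab_fixed m"
proof -
  have fc: "f \<in> carrier (nsym n)" using f by (simp add: supported_tuples_def)
  have "D p (\<rho> f v) = \<rho> f v" if p: "p permutes {m<..}" for p
  proof -
    have p1: "p permutes {1..}" by (rule permutes_subset[OF p]) auto
    have "p \<circ> f i = f i \<circ> p" if "i \<in> {1..n}" for i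
      using f that by (intro permutes_disjoint_commute[OF p]) (auto simp: supported_tuples_def)
    then have "diag n p \<otimes>\<^bsub>nsym n\<^esub> f = f \<otimes>\<^bsub>nsym n\<^esub> diag n p" by auto
    then have "D p (\<rho> f v) = \<rho> f (D p v)"
      unfolding D_def using rho_mult[OF diag_in_nsym[OF p1] fc] rho_mult[OF fc diag_in_nsym[OF p1]] by metis
    then show ?thesis using v p1 by (simp add: H0_def)
  qed
  then show ?thesis by (simp add: stab_fixed_def)
qed

section \<open>Commuting compressions to the K-fixed vectors\<close>

text \<open>The inner projection can be replaced by a shift of \<open>h\<close> away from the
  support of \<open>f\<close>. The shifted tuple commutes with \<open>f\<close>, and the computation
  is then run backwards with the two roles exchanged.\<close>

lemma compression_commute_supported:
  assumes f: "f \<in> supported_tuples n m" and h: "h \<in> supported_tuples n m"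
    and v: "v \<in> H0" and w: "w \<in> H0"
  shows "inner (\<rho> f (proj (\<rho> h v))) w = inner (\<rho> h (proj (\<rho> f v))) w"
proof -
  obtain t where t: "t permutes {1..}" and t_eq: "\<And>i. i \<in> {1..m} \<Longrightarrow> t i = i + m"
    using extend_inj_on_permutes[of "{1..m}" "\<lambda>i. i + m" "{1..}"] by auto
  have disj: "t ` {1..m} \<inter> id ` {1..m} = {}" "id ` {1..m} \<inter> t ` {1..m} = {}"
    by (auto simp: t_eq)
  have fc: "f \<in> carrier (nsym n)" and hc: "h \<in> carrier (nsym n)"
    using f h by (auto simp: supported_tuples_def)
  have tc: "diag n t \<in> carrier (nsym n)" and itc: "diag n (Hilbert_Choice.inv t) \<in> carrier (nsym n)"
    using t by (auto intro!: diag_in_nsym permutes_inv simp del: One_nat_def)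
  \<comment> \<open>The conjugate of \<open>h\<close> that acts on m+1, ..., 2m.\<close>
  define h' where "h' = diag n t \<otimes>\<^bsub>nsym n\<^esub> h \<otimes>\<^bsub>nsym n\<^esub> diag n (Hilbert_Choice.inv t)"
  have h'c: "h' \<in> carrier (nsym n)" unfolding h'_def using tc itc hc by (intro m_closed)
  have rho_h': "\<rho> h' x = D t (\<rho> h (D (Hilbert_Choice.inv t) x))" for x
    unfolding h'_def D_def by (simp only: rho_mult tc hc itc m_closed)
  have "f i \<circ> h' i = h' i \<circ> f i" if i: "i \<in> {1..n}" for i
  proof -
    have "h' i = t \<circ> h i \<circ> Hilbert_Choice.inv t" using i by (simp add: h'_def)
    moreover have "t \<circ> h i \<circ> Hilbert_Choice.inv t permutes t ` {1..m}"
      using h i by (intro permutes_conj[OF t]) (auto simp: supported_tuples_def)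
    moreover have "f i permutes {1..m}" using f i by (simp add: supported_tuples_def)
    moreover have "{1..m} \<inter> t ` {1..m} = {}" using disj(2) by simp
    ultimately show ?thesis using permutes_disjoint_commute by metis
  qed
  then have "f \<otimes>\<^bsub>nsym n\<^esub> h' = h' \<otimes>\<^bsub>nsym n\<^esub> f" by auto
  then have comm: "\<rho> f (\<rho> h' v) = \<rho> h' (\<rho> f v)"
    using rho_mult[OF fc h'c] rho_mult[OF h'c fc] by metis
  have fixed: "D t z = z" "D (Hilbert_Choice.inv t) z = z" if "z \<in> H0" for z
    using that t permutes_inv[OF t] by (auto simp: H0_def)
  note sf = supported_stab_fixed
  have "inner (\<rho> f (proj (\<rho> h v))) w = inner (proj (\<rho> h v)) (\<rho> (inv\<^bsub>nsym n\<^esub> f) w)"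
    by (rule rho_adjoint[OF fc])
  also have "\<dots> = inner (D t (\<rho> h v)) (D id (\<rho> (inv\<^bsub>nsym n\<^esub> f) w))"
    by (rule inner_proj_disjoint[OF sf[OF h v] sf[OF supported_tuples_inv[OF f] w] t permutes_id disj(1)])
  also have "\<dots> = inner (\<rho> f (\<rho> h' v)) w"
    by (simp only: D_id rho_adjoint[OF fc] rho_h' fixed v)
  \<comment> \<open>After commuting, \<open>w\<close> is written as \<open>D t w\<close>, so that
    the outer \<open>D t\<close> of \<open>\<rho> h'\<close> cancels and its inverse is left on
    \<open>\<rho> f v\<close>.\<close>
  also have "\<dots> = inner (\<rho> h' (\<rho> f v)) (D t w)"
    by (simp only: comm fixed w)
  also have "\<dots> = inner (D t (\<rho> h (D (Hilbert_Choice.inv t) (\<rho> f v)))) (D t w)"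
    by (simp only: rho_h')
  also have "\<dots> = inner (D (Hilbert_Choice.inv t) (\<rho> f v)) (\<rho> (inv\<^bsub>nsym n\<^esub> h) w)"
    by (simp only: D_inner[OF t] rho_adjoint[OF hc])
  also have "\<dots> = inner (D id (\<rho> f v)) (D t (\<rho> (inv\<^bsub>nsym n\<^esub> h) w))"
    by (simp only: D_adjoint[OF permutes_inv[OF t]] permutes_inv_inv[OF t] D_id)
  also have "\<dots> = inner (proj (\<rho> f v)) (\<rho> (inv\<^bsub>nsym n\<^esub> h) w)"
    by (rule inner_proj_disjoint[OF sf[OF f v] sf[OF supported_tuples_inv[OF h] w] permutes_id t disj(2), symmetric])
  also have "\<dots> = inner (\<rho> h (proj (\<rho> f v))) w"
    by (rule rho_adjoint[OF hc, symmetric])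
  finally show ?thesis .
qed

text \<open>The diagonal factor in the decomposition of \<open>g\<close> acts trivially on
  \<open>H0\<close>.\<close>

lemma rho_on_H0:
  assumes g: "g \<in> carrier (nsym n)"
  obtains f m where "f \<in> supported_tuples n m" "\<And>v. v \<in> H0 \<Longrightarrow> \<rho> g v = \<rho> f v"
proof -
  obtain m f p where f: "f \<in> supported_tuples n m" and p: "p permutes {1..}"
    and g_eq: "g = f \<otimes>\<^bsub>nsym n\<^esub> diag n p"
    using nsym_decompose[OF n_pos g] by blast
  have "f \<in> carrier (nsym n)" using f by (simp add: supported_tuples_def)
  then have "\<rho> g v = \<rho> f (D p v)" for v
    unfolding g_eq D_def by (rule rho_mult[OF _ diag_in_nsym[OF p]])
  then show ?thesis using f p by (intro that[of f m]) (auto simp: H0_def)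
qed

text \<open>The operator on \<open>H0\<close> attached to the double coset of \<open>g\<close>,
  extended by zero to the orthogonal complement so that it acts on the whole space.\<close>

definition compression where "compression g x = proj (\<rho> g (proj x))"

lemma compression_commute:
  assumes g: "g \<in> carrier (nsym n)" and h: "h \<in> carrier (nsym n)"
  shows "compression g (compression h x) = compression h (compression g x)"
proof -
  obtain f m where f: "f \<in> supported_tuples n m" "\<And>v. v \<in> H0 \<Longrightarrow> \<rho> g v = \<rho> f v"
    using rho_on_H0[OF g] by blast
  obtain k l where k: "k \<in> supported_tuples n l" "\<And>v. v \<in> H0 \<Longrightarrow> \<rho> h v = \<rho> k v"
    using rho_on_H0[OF h] by blast
  have fk: "f \<in> supported_tuples n (max m l)" "k \<in> supported_tuples n (max m l)"
    using f(1) k(1) supported_tuples_mono[of m "max m l" n] supported_tuples_mono[of l "max m l" n] by auto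
  have "inner (compression g (compression h x)) y = inner (compression h (compression g x)) y" for y
    using compression_commute_supported[OF fk proj_in_H0[of x] proj_in_H0[of y]]
    by (simp add: compression_def proj_proj proj_adjoint[of _ y] f(2) k(2) proj_in_H0)
  from this[of "compression g (compression h x) - compression h (compression g x)"]
  have "inner (compression g (compression h x) - compression h (compression g x))
      (compression g (compression h x) - compression h (compression g x)) = 0"
    by (simp add: inner_diff_left)
  then show ?thesis by simp
qed

lemma compression_adjoint:
  "g \<in> carrier (nsym n) \<Longrightarrow> inner (compression g x) y = inner x (compression (inv\<^bsub>nsym n\<^esub> g) y)"
  by (simp only: compression_def proj_adjoint rho_adjoint)

lemma compression_bounded_linear: "g \<in> carrier (nsym n) \<Longrightarrow> bounded_linear (compression g)"
  unfolding compression_def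
  by (intro bounded_linear_compose[OF proj_bounded_linear] bounded_linear_compose[OF rho_bounded_linear]
      proj_bounded_linear)

lemma compression_scaleC:
  "g \<in> carrier (nsym n) \<Longrightarrow> compression g (c *\<^sub>C x) = c *\<^sub>C compression g x"
  by (simp add: compression_def proj_scaleC rho_scaleC)

lemma compression_proj: "compression g (proj x) = compression g x" "proj (compression g x) = compression g x"
  by (simp_all add: compression_def proj_proj)

section \<open>Irreducibility and the dimension bound\<close>

lemma cyclic:
  assumes irr: "irreducible_rep (nsym n) \<rho>"
    and V: "complex_vector.subspace V" "closed V" and z: "z \<noteq> 0"
    and orbit: "\<And>g. g \<in> carrier (nsym n) \<Longrightarrow> \<rho> g z \<in> V"
  shows "V = UNIV"
proof -
  \<comment> \<open>The vectors whose whole orbit stays in \<open>V\<close> form a closed invariant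
    subspace, and \<open>z\<close> is one of them.\<close>
  define W where "W = {x. \<forall>g\<in>carrier (nsym n). \<rho> g x \<in> V}"
  have zero: "\<rho> g 0 = 0" if "g \<in> carrier (nsym n)" for g
    using linear_simps(3)[OF rho_bounded_linear[OF that]] .
  have "complex_vector.subspace W"
    using V(1) by (simp add: complex_vector.subspace_def W_def rho_add rho_scaleC zero)
  moreover have "closed W"
  proof -
    have "closed (\<rho> g -` V)" if "g \<in> carrier (nsym n)" for g
      by (intro continuous_closed_vimage V(2) linear_continuous_at rho_bounded_linear that)
    moreover have "W = (\<Inter>g\<in>carrier (nsym n). \<rho> g -` V)" by (auto simp: W_def)
    ultimately show ?thesis by auto
  qed
  moreover have "\<rho> h ` W \<subseteq> W" if "h \<in> carrier (nsym n)" for h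
    using that by (auto simp: W_def rho_mult[symmetric] simp del: nsym_simps)
  ultimately have "W = {0} \<or> W = UNIV" using irr unfolding irreducible_rep_def by blast
  moreover have "z \<in> W" using orbit by (simp add: W_def)
  ultimately have "W = UNIV" using z by blast
  then have "\<rho> \<one>\<^bsub>nsym n\<^esub> x \<in> V" for x using one_closed by (auto simp: W_def simp del: nsym_simps)
  then show ?thesis by (simp only: rho_one) blast
qed

lemma commutant_scalar:
  assumes irr: "irreducible_rep (nsym n) \<rho>"
    and T: "bounded_linear T" "\<And>c x. T (c *\<^sub>C x) = c *\<^sub>C T x" "\<And>x y. inner (T x) y = inner x (T y)"
    and TP: "\<And>x. T (proj x) = proj (T x)"
    and TA: "\<And>g x. g \<in> carrier (nsym n) \<Longrightarrow> T (compression g x) = compression g (T x)"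
  shows "\<exists>c. \<forall>v\<in>H0. T v = c *\<^sub>R v"
proof -
  have "\<exists>c. \<forall>x. T (proj x) = c *\<^sub>R proj x"
  proof (rule schur_compressed[where R = "\<rho> ` carrier (nsym n)"])
    show "V = UNIV" if "complex_vector.subspace V" "closed V" "z \<noteq> 0"
      "\<And>r. r \<in> \<rho> ` carrier (nsym n) \<Longrightarrow> r z \<in> V" for V z
      using cyclic[OF irr that(1-3)] that(4) by blast
    show "T (proj (r (proj x))) = proj (r (proj (T x)))" if "r \<in> \<rho> ` carrier (nsym n)" for r x
      using that TA by (auto simp: compression_def)
  qed (auto simp: rho_bounded_linear proj_bounded_linear proj_scaleC proj_proj T TP)
  then show ?thesis by (metis proj_H0)
qed

text \<open>The adjoint of a compression is the compression of the inverse, and all compressions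
  commute. So the self-adjoint case applies to the real and imaginary parts of \<open>A\<close>,
  taken up to constant factors.\<close>

lemma compression_scalar:
  assumes irr: "irreducible_rep (nsym n) \<rho>" and g: "g \<in> carrier (nsym n)"
  shows "\<exists>c. \<forall>v\<in>H0. compression g v = c *\<^sub>C v"
proof -
  define A B where "A = compression g" and "B = compression (inv\<^bsub>nsym n\<^esub> g)"
  have g': "inv\<^bsub>nsym n\<^esub> g \<in> carrier (nsym n)" using g by (rule inv_closed)
  have A: "bounded_linear A" and B: "bounded_linear B"
    unfolding A_def B_def by (rule compression_bounded_linear[OF g] compression_bounded_linear[OF g'])+
  have AC: "A (c *\<^sub>C x) = c *\<^sub>C A x" and BC: "B (c *\<^sub>C x) = c *\<^sub>C B x" for c x
    unfolding A_def B_def by (rule compression_scaleC[OF g] compression_scaleC[OF g'])+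
  have AB: "inner (A x) y = inner x (B y)" and BA: "inner (B x) y = inner x (A y)" for x y
    unfolding A_def B_def using compression_adjoint[OF g] compression_adjoint[OF g'] inv_inv[OF g] by auto
  have comm: "A (compression h x) = compression h (A x)" "B (compression h x) = compression h (B x)"
    if "h \<in> carrier (nsym n)" for h x
    unfolding A_def B_def using compression_commute[OF g that] compression_commute[OF g' that] by auto
  have AP: "A (proj x) = A x" "proj (A x) = A x" "B (proj x) = B x" "proj (B x) = B x" for x
    unfolding A_def B_def by (rule compression_proj)+
  note lin = linear_simps[OF proj_bounded_linear]
  have "\<exists>c. \<forall>v\<in>H0. A v + B v = c *\<^sub>R v"
  proof (rule commutant_scalar[OF irr])
    show "A (compression h x) + B (compression h x) = compression h (A x + B x)"
      if "h \<in> carrier (nsym n)" for h x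
      using comm[OF that] linear_simps(1)[OF compression_bounded_linear[OF that]] by simp
  qed (auto simp: bounded_linear_add A B AC BC AB BA AP lin inner_add_left inner_add_right
      scaleC_add_right)
  then obtain a where a: "\<And>v. v \<in> H0 \<Longrightarrow> A v + B v = a *\<^sub>R v" by blast
  have "\<exists>c. \<forall>v\<in>H0. \<i> *\<^sub>C (A v - B v) = c *\<^sub>R v"
  proof (rule commutant_scalar[OF irr])
    show "bounded_linear (\<lambda>x. \<i> *\<^sub>C (A x - B x))"
      by (intro bounded_linear_compose[OF bounded_linear_scaleC] bounded_linear_sub A B)
    show "\<i> *\<^sub>C (A (c *\<^sub>C x) - B (c *\<^sub>C x)) = c *\<^sub>C \<i> *\<^sub>C (A x - B x)" for c x
      by (simp add: AC BC complex_vector.scale_right_diff_distrib scaleC_scaleC mult.commute)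
    show "inner (\<i> *\<^sub>C (A x - B x)) y = inner x (\<i> *\<^sub>C (A y - B y))" for x y
      by (simp add: inner_i inner_diff_left inner_diff_right AB BA AC BC complex_vector.scale_right_diff_distrib)
    show "\<i> *\<^sub>C (A (proj x) - B (proj x)) = proj (\<i> *\<^sub>C (A x - B x))" for x
      by (simp add: proj_scaleC lin AP)
    show "\<i> *\<^sub>C (A (compression h x) - B (compression h x)) = compression h (\<i> *\<^sub>C (A x - B x))"
      if "h \<in> carrier (nsym n)" for h x
      using comm[OF that] linear_simps(2)[OF compression_bounded_linear[OF that]]
      by (simp add: compression_scaleC[OF that])
  qed
  then obtain b where b: "\<And>v. v \<in> H0 \<Longrightarrow> \<i> *\<^sub>C (A v - B v) = b *\<^sub>R v" by blast
  \<comment> \<open>Solves the two scalar equations for \<open>A\<close>: the sum with its adjoint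
    is \<open>a\<close>, and the imaginary unit times the difference is \<open>b\<close>.\<close>
  have "A v = (Complex (a / 2) (- b / 2)) *\<^sub>C v" if v: "v \<in> H0" for v
  proof -
    have "A v - B v = - (\<i> *\<^sub>C (b *\<^sub>R v))" unfolding b[OF v, symmetric] by simp
    also have "\<dots> = - (b *\<^sub>R (\<i> *\<^sub>C v))" by (simp add: scaleR_scaleC scaleC_scaleC mult.commute)
    finally have "A v + A v = a *\<^sub>R v - b *\<^sub>R (\<i> *\<^sub>C v)"
      using a[OF v] by (simp add: algebra_simps)
    then have "A v = (1/2) *\<^sub>R (a *\<^sub>R v - b *\<^sub>R (\<i> *\<^sub>C v))"
      using scaleR_half_double[of "A v"] by simp
    then show ?thesis
      using scaleC_Re_Im[of "Complex (a / 2) (- b / 2)" v] by (simp add: scaleR_diff_right)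
  qed
  then show ?thesis by (auto simp: A_def)
qed

text \<open>Each \<open>proj (\<rho> g v)\<close> is a multiple of \<open>v\<close>, and the orbit
  of \<open>v\<close> lies in no proper closed subspace; hence \<open>proj\<close> maps everything
  into the line through \<open>v\<close>.\<close>

lemma H0_one_dimensional:
  assumes irr: "irreducible_rep (nsym n) \<rho>" and v: "v \<in> H0" "v \<noteq> 0"
  shows "H0 = complex_vector.span {v}"
proof
  show "complex_vector.span {v} \<subseteq> H0"
    using v(1) by (intro complex_vector.span_minimal complex_subspace_H0) simp
  have vv: "cinner v v \<noteq> 0" using v(2) by (simp add: cinner_inner complex_eq_iff)
  \<comment> \<open>\<open>F x\<close> vanishes exactly when \<open>proj x\<close> is the orthogonal
    projection of \<open>x\<close> to the line through \<open>v\<close>. Clearing the denominator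
    keeps \<open>F\<close> visibly linear.\<close>
  define F where "F x = cinner v v *\<^sub>C proj x - cinner x v *\<^sub>C v" for x
  have "cinner x v *\<^sub>C v = inner x v *\<^sub>R v + inner x (\<i> *\<^sub>C v) *\<^sub>R (\<i> *\<^sub>C v)" for x
    using scaleC_Re_Im[of "cinner x v" v] by (simp only: cinner_inner complex.sel)
  then have "bounded_linear F"
    unfolding F_def
    by (simp, intro bounded_linear_sub bounded_linear_add bounded_linear_compose[OF bounded_linear_scaleC]
      proj_bounded_linear bounded_linear_scaleR_const bounded_linear_inner_left)
  moreover have "F (c *\<^sub>C x) = c *\<^sub>C F x" for c x
    by (simp add: F_def proj_scaleC cinner_scaleC_left scaleC_scaleC mult.commute
        complex_vector.scale_right_diff_distrib)
  ultimately have V: "complex_vector.subspace {x. F x = 0}" "closed {x. F x = 0}"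
    by (rule closed_subspace_kernel)+
  have "{x. F x = 0} = UNIV"
  proof (rule cyclic[OF irr V v(2)])
    fix g assume g: "g \<in> carrier (nsym n)"
    obtain c where "compression g v = c *\<^sub>C v" using compression_scalar[OF irr g] v(1) by blast
    then have c: "proj (\<rho> g v) = c *\<^sub>C v" by (simp add: compression_def proj_H0 v(1))
    have iv: "\<i> *\<^sub>C v \<in> H0" using v(1) complex_subspace_H0 by (simp add: complex_vector.subspace_scale)
    have "cinner (\<rho> g v) v = cinner (proj (\<rho> g v)) v"
      by (simp add: cinner_inner proj_adjoint proj_H0 v(1) iv)
    then show "\<rho> g v \<in> {x. F x = 0}"
      by (simp add: F_def c cinner_scaleC_left scaleC_scaleC mult.commute)
  qed
  then have F: "F x = 0" for x by blast
  show "H0 \<subseteq> complex_vector.span {v}"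
  proof
    fix w assume "w \<in> H0"
    then have "cinner v v *\<^sub>C w = cinner w v *\<^sub>C v" using F[of w] by (simp add: F_def proj_H0)
    then have "w = (cinner w v / cinner v v) *\<^sub>C v"
      using vv by (metis complex_vector.vector_space_assms(3) complex_vector.scale_one nonzero_divide_eq_eq
          divide_inverse mult.commute right_inverse scaleC_scaleC)
    then show "w \<in> complex_vector.span {v}"
      by (metis complex_vector.span_base complex_vector.span_scale insertI1)
  qed
qed

lemma H0_dimension:
  assumes "irreducible_rep (nsym n) \<rho>"
  shows "cdim_le H0 1"
proof -
  obtain B where B: "finite B" "card B \<le> 1" "complex_vector.span B = H0"
  proof (cases "\<exists>v\<in>H0. v \<noteq> 0")
    case True
    then obtain v where "v \<in> H0" "v \<noteq> 0" by blast
    then show ?thesis using H0_one_dimensional[OF assms] by (intro that[of "{v}"]) auto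
  next
    case False
    then have "H0 = {0}" using complex_vector.subspace_0[OF complex_subspace_H0] by blast
    then show ?thesis using that[of "{}"] by simp
  qed
  then have "complex_vector.dim H0 \<le> 1"
    using complex_vector.dim_le_card[of H0 B] by simp
  with B show ?thesis unfolding cdim_le_def by blast
qed

end

theorem theorem6p11:
  fixes n :: nat
    and \<rho> :: "(nat \<Rightarrow> nat \<Rightarrow> nat) \<Rightarrow> 'a \<Rightarrow> 'a :: complex_hilbert_space"
  assumes "n \<ge> 2"
    and "unitary_rep (nsym n) (nsym_topology n) \<rho>"
    and "irreducible_rep (nsym n) \<rho>"
  shows "cdim_le (fixed_vectors (diag_stab n 0) \<rho>) 1"
proof -
  interpret nsym_unitary n \<rho>
    using assms(1,2) by unfold_locales (auto simp: unitary_rep_def)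
  have "fixed_vectors (diag_stab n 0) \<rho> = H0"
    by (simp add: fixed_vectors_def diag_stab_0 H0_def D_def)
  then show ?thesis using H0_dimension[OF assms(3)] by simp
qed

end
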